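(* Let $f\in\mathcal{K}_H^0$ and $0\le\alpha<1$. Then $f$ is fully starlike of order $\alpha$ in at least $|z|<r_S$, where $r_S$ is the real root of the equation $$(2-\alpha)(1-r)^3+\alpha r(1-r)^2-1-r=0$$ in $(0,1)$.
   Context: Let $\mathbb{D}=\{z\in\mathbb{C}:|z|<1\}$. $\mathcal{S}_H$ is the class of univalent sense-preserving complex-valued harmonic functions $f=h+\overline{g}$ in $\mathbb{D}$, where $h(z)=z+\sum_{n\ge2}a_nz^n$ and $g(z)=\sum_{n\ge1}b_nz^n$ are analytic in $\mathbb{D}$ and $|g'(z)|<|h'(z)|$ in $\mathbb{D}$. $\mathcal{K}_H^0$ is the class of all $f\in\mathcal{S}_H$ such that $f(\mathbb{D})$ is convex and $f_{\bar z}(0)=0$. A complex-valued harmonic function $f$ with $f(0)=0$ is said to be fully starlike of order $\alpha$ ($0\le\alpha<1$) in a disk $|z|<\rho$ if, for every $0<r<\rho$, $f$ maps the circle $|z|=r$ in a one-to-one manner onto a curve that bounds a domain starlike with respect to the origin and satisfies $\frac{\partial}{\partial\theta}\arg f(re^{i\theta})>\alpha$ for $0\le\theta\le2\pi$. *)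

theory Defs
  imports "HOL-Complex_Analysis.Complex_Analysis"
begin

abbreviation unit_disk :: "complex set" where
  "unit_disk \<equiv> ball 0 1"

text \<open>Real directional derivative; the directions \<open>1\<close> and \<open>\<i>\<close> give the partial derivatives
  with respect to \<open>x\<close> and \<open>y\<close>, where \<open>z = x + \<i> y\<close>.\<close>

definition dir_deriv :: "complex \<Rightarrow> (complex \<Rightarrow> complex) \<Rightarrow> complex \<Rightarrow> complex" where
  "dir_deriv u f z = frechet_derivative f (at z) u"

definition wirtinger_bar :: "(complex \<Rightarrow> complex) \<Rightarrow> complex \<Rightarrow> complex" where
  "wirtinger_bar f z = (dir_deriv 1 f z + \<i> * dir_deriv \<i> f z) / 2"

definition harmonic_on :: "(complex \<Rightarrow> complex) \<Rightarrow> complex set \<Rightarrow> bool" where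
  "harmonic_on f S \<longleftrightarrow> open S \<and> f differentiable_on S \<and>
     (\<forall>u\<in>{1, \<i>}. dir_deriv u f differentiable_on S \<and>
        (\<forall>v\<in>{1, \<i>}. continuous_on S (dir_deriv v (dir_deriv u f)))) \<and>
     (\<forall>z\<in>S. dir_deriv 1 (dir_deriv 1 f) z + dir_deriv \<i> (dir_deriv \<i> f) z = 0)"

text \<open>For \<open>f = h + cnj g\<close> the Jacobian is \<open>|h'|\<^sup>2 - |g'|\<^sup>2\<close>, so the last condition is the
  sense-preserving property.\<close>

definition S_H :: "(complex \<Rightarrow> complex) set" where
  "S_H = {f. harmonic_on f unit_disk \<and> inj_on f unit_disk \<and>
     (\<exists>h g a b.
        h holomorphic_on unit_disk \<and> g holomorphic_on unit_disk \<and>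
        a 0 = 0 \<and> a 1 = 1 \<and> b 0 = 0 \<and>
        (\<forall>z\<in>unit_disk. (\<lambda>n. a n * z ^ n) sums h z) \<and>
        (\<forall>z\<in>unit_disk. (\<lambda>n. b n * z ^ n) sums g z) \<and>
        (\<forall>z\<in>unit_disk. f z = h z + cnj (g z)) \<and>
        (\<forall>z\<in>unit_disk. norm (deriv g z) < norm (deriv h z)))}"

definition K_H0 :: "(complex \<Rightarrow> complex) set" where
  "K_H0 = {f \<in> S_H. convex (f ` unit_disk) \<and> wirtinger_bar f 0 = 0}"

definition starlike_domain :: "complex set \<Rightarrow> bool" where
  "starlike_domain D \<longleftrightarrow> open D \<and> connected D \<and> 0 \<in> D \<and> (\<forall>w\<in>D. closed_segment 0 w \<subseteq> D)"

text \<open>A continuous branch of \<open>arg\<close> along a closed curve around the origin is in general not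
  periodic, so it is taken on the whole real line; on a curve avoiding the origin it is unique
  up to a constant.\<close>

definition arg_branch :: "(real \<Rightarrow> complex) \<Rightarrow> (real \<Rightarrow> real) \<Rightarrow> bool" where
  "arg_branch \<gamma> \<phi> \<longleftrightarrow> continuous_on UNIV \<phi> \<and>
     (\<forall>t. \<gamma> t \<noteq> 0 \<and> \<gamma> t = of_real (norm (\<gamma> t)) * cis (\<phi> t))"

text \<open>Boundedness of \<open>D\<close> selects the domain enclosed by the curve.\<close>

definition fully_starlike_of_order :: "real \<Rightarrow> real \<Rightarrow> (complex \<Rightarrow> complex) \<Rightarrow> bool" where
  "fully_starlike_of_order \<alpha> \<rho> f \<longleftrightarrow>
     harmonic_on f (ball 0 \<rho>) \<and> f 0 = 0 \<and>
     (\<forall>r. 0 < r \<and> r < \<rho> \<longrightarrow>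
        inj_on f (sphere 0 r) \<and>
        (\<exists>D. starlike_domain D \<and> bounded D \<and> frontier D = f ` sphere 0 r) \<and>
        (\<exists>\<phi>. arg_branch (\<lambda>\<theta>. f (of_real r * cis \<theta>)) \<phi> \<and>
           (\<forall>\<theta>\<in>{0..2 * pi}. \<exists>d. (\<phi> has_real_derivative d) (at \<theta>) \<and> d > \<alpha>)))"

end

theory Submission
  imports Defs "HOL-Real_Asymp.Real_Asymp"
begin

text \<open>For \<open>f = h + cnj g\<close> the derivative of the argument along the circle \<open>|z| = r\<close> is
\<open>Re (A / f)\<close> with \<open>A = z h' - cnj (z g')\<close>, so everything comes down to the inequality
\<open>Re (A / f) > \<alpha>\<close> for \<open>0 < |z| < r\<^sub>S\<close>.

Convexity of the image is used to reduce to univalent analytic functions: integrating along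
preimages of segments shows \<open>|g z2 - g z1| < |h z2 - h z1|\<close>
(\<open>convex_harmonic_difference_bound\<close>), so \<open>h + \<epsilon> g\<close> is univalent in the disk whenever
\<open>|\<epsilon>| = 1\<close>. Bieberbach's theorem \<open>|a\<^sub>2| \<le> 2\<close>, derived here from the area theorem
(\<open>area_theorem_linear_coefficient\<close>, \<open>bieberbach_second_coefficient\<close>), and its consequence, the
Koebe distortion theorem, therefore bound these functions. Choosing \<open>\<epsilon>\<close> at each point so that
the two terms align gives \<open>|h'| + |g'| \<le> K\<close> and \<open>|h''| + |g''| \<le> K'\<close> at distance \<open>r\<close>
from the origin, where \<open>K(r) = (1 + r) / (1 - r)\<^sup>3\<close> (\<open>pair_distortion\<close>). Since
\<open>wirtinger_bar f 0 = 0\<close>, the dilatation \<open>g' / h'\<close> vanishes at the origin, and the Schwarz lemma gives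
the bound for \<open>g\<close> alone, \<open>|g| \<le> r\<^sup>2 / (2 (1 - r)\<^sup>2)\<close> (\<open>coanalytic_part_growth\<close>).

Now \<open>Re (A / f) \<le> \<alpha>\<close> would mean \<open>A = (1 - v) f\<close> for some \<open>v\<close> with \<open>Re v \<ge> 1 - \<alpha>\<close>. To first
order at the origin \<open>(A - (1 - v) f) / z\<close> is \<open>v\<close>, and the remainder is an integral of \<open>h''\<close> and
\<open>g''\<close> along the ray to \<open>z\<close>. By the three bounds the remainder is too small to cancel \<open>v\<close> as long
as \<open>K(r) < 2 - \<alpha> + \<alpha> r / (1 - r)\<close> (\<open>argument_derivative_lower_bound\<close>). Multiplied by
\<open>(1 - r)\<^sup>3\<close>, this is positivity of the polynomial that defines \<open>r\<^sub>S\<close>, which decreases on \<open>[0, 1]\<close>.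

Finally, the inequality makes \<open>f (ball 0 r)\<close> starlike: by convexity the segment from \<open>0\<close> to a
point of it has a preimage, and that curve can cross the circle \<open>|z| = r\<close> only outwards
(\<open>image_disk_starlike\<close>). The frontier of \<open>f (ball 0 r)\<close> is the image of the circle because \<open>f\<close> is
injective and open.\<close>

unbundle no fps_syntax


section \<open>The area theorem\<close>

text \<open>Areas of images are computed in \<open>real^2\<close>, but integrated iteratively over
\<open>real \<times> real\<close>; this lemma identifies the two integrals over a rectangle.\<close>

lemma has_integral_real2_from_product:
  fixes f :: "real \<times> real \<Rightarrow> real"
  assumes "(f has_integral i) (cbox (a, c) (b, d))"
  shows "((\<lambda>v::real^2. f (v$1, v$2)) has_integral i) (cbox (vector [a, c]) (vector [b, d]))"
proof -
  define g where "g = (\<lambda>v::real^2. (v$1, v$2))"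
  define h where "h = (\<lambda>p::real\<times>real. (vector [fst p, snd p] :: real^2))"
  have hg: "h (g x) = x" for x
    by (simp add: h_def g_def vec_eq_iff forall_2)
  have gh: "g (h x) = x" for x
    by (simp add: h_def g_def)
  have gbox: "g ` cbox u v = cbox (u$1, u$2) (v$1, v$2)" for u v
  proof -
    have "p \<in> g ` cbox u v" if "p \<in> cbox (u$1, u$2) (v$1, v$2)" for p
      by (rule image_eqI[of _ _ "h p"])
         (use that gh in \<open>auto simp: h_def cbox_Pair_eq mem_box_cart forall_2\<close>)
    then show ?thesis
      by (auto simp: g_def cbox_Pair_eq mem_box_cart forall_2)
  qed
  have hbox: "h ` cbox u v = cbox (vector [fst u, snd u]) (vector [fst v, snd v])" for u v
  proof -
    have "g ` cbox (vector [fst u, snd u]) (vector [fst v, snd v]) = cbox u v"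
      by (simp add: gbox)
    then have "h ` cbox u v = h ` g ` cbox (vector [fst u, snd u]) (vector [fst v, snd v])"
      by simp
    then show ?thesis
      by (simp add: image_image hg)
  qed
  have "((\<lambda>x. f (g x)) has_integral (1 / 1) *\<^sub>R i) (h ` cbox (a, c) (b, d))"
  proof (rule has_integral_twiddle)
    show "isCont g x" for x
      unfolding g_def by (intro continuous_intros)
    show "Henstock_Kurzweil_Integration.content (g ` cbox u v) = 1 * Henstock_Kurzweil_Integration.content (cbox u v)" for u v
    proof (cases "cbox u v = {}")
      case True
      then show ?thesis by simp
    next
      case False
      then have *: "u$1 \<le> v$1" "u$2 \<le> v$2"
        by (auto simp: interval_ne_empty_cart forall_2)
      have "Henstock_Kurzweil_Integration.content (cbox u v) = (v$1 - u$1) * (v$2 - u$2)"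
        using False by (simp add: content_cbox_cart UNIV_2)
      moreover have "Henstock_Kurzweil_Integration.content (cbox (u$1, u$2) (v$1, v$2)) = (v$1 - u$1) * (v$2 - u$2)"
        using * by (simp add: content_Pair content_real)
      ultimately show ?thesis by (simp add: gbox)
    qed
  qed (use assms hg gh gbox hbox in auto)
  then show ?thesis
    by (simp add: hbox g_def)
qed

text \<open>The map \<open>w \<mapsto> w - c * cnj w\<close> is real-linear of determinant \<open>1 - |c|\<^sup>2\<close>, so following the
injective holomorphic \<open>H\<close> by it gives a map of Jacobian \<open>(1 - |c|\<^sup>2) |H'|\<^sup>2\<close>, and the area of its
image is at most that of a disk containing the image. The twist by \<open>c\<close> serves below to straighten
an ellipse into a circle.\<close>

lemma area_twisted_image_le:
  fixes H :: "complex \<Rightarrow> complex" and c :: complex and a b p q M :: real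
  assumes "open S" and holH: "H holomorphic_on S"
    and sub: "\<And>x y. a \<le> x \<Longrightarrow> x \<le> b \<Longrightarrow> p \<le> y \<Longrightarrow> y \<le> q \<Longrightarrow> Complex x y \<in> S"
    and inj: "inj_on H {z. a < Re z \<and> Re z < b \<and> p < Im z \<and> Im z < q}"
    and c: "cmod c < 1" and M: "0 \<le> M"
    and bd: "\<And>z. a < Re z \<Longrightarrow> Re z < b \<Longrightarrow> p < Im z \<Longrightarrow> Im z < q \<Longrightarrow>
               cmod (H z - c * cnj (H z)) \<le> M"
  shows "(1 - (cmod c)\<^sup>2) *
           integral {a..b} (\<lambda>x. integral {p..q} (\<lambda>y. (cmod (deriv H (Complex x y)))\<^sup>2)) \<le> pi * M\<^sup>2"
proof -
  define T where "T = (\<lambda>w. w - c * cnj w)"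
  define V where "V = (\<lambda>w. vector [Re w, Im w] :: real^2)"
  define Z where "Z = (\<lambda>v::real^2. Complex (v$1) (v$2))"
  define g where "g = (\<lambda>v. V (T (H (Z v))))"
  define g' where "g' = (\<lambda>v u. V (T (deriv H (Z v) * Z u)))"
  define R where "R = box (vector [a, p] :: real^2) (vector [b, q])"
  define I where "I = integral {a..b} (\<lambda>x. integral {p..q} (\<lambda>y. (cmod (deriv H (Complex x y)))\<^sup>2))"
  have linV: "bounded_linear V"
  proof -
    have "V w = Re w *\<^sub>R axis 1 1 + Im w *\<^sub>R axis 2 1" for w
      by (simp add: V_def vec_eq_iff forall_2 axis_def)
    then have "V = (\<lambda>w. Re w *\<^sub>R axis 1 1 + Im w *\<^sub>R axis 2 1)" by blast
    then show ?thesis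
      by (auto intro!: bounded_linear_add bounded_linear_scaleR_const bounded_linear_Re bounded_linear_Im)
  qed
  have linZ: "bounded_linear Z"
  proof -
    have "Z v = v $ 1 *\<^sub>R 1 + v $ 2 *\<^sub>R \<i>" for v
      by (simp add: Z_def complex_eq_iff)
    then have "Z = (\<lambda>v. v $ 1 *\<^sub>R 1 + v $ 2 *\<^sub>R \<i>)" by blast
    then show ?thesis
      by (auto intro!: bounded_linear_add bounded_linear_scaleR_const bounded_linear_vec_nth)
  qed
  have linT: "bounded_linear T"
    unfolding T_def
    by (intro bounded_linear_sub bounded_linear_ident bounded_linear_const_mult bounded_linear_cnj)
  have memR: "v \<in> R \<longleftrightarrow> a < Re (Z v) \<and> Re (Z v) < b \<and> p < Im (Z v) \<and> Im (Z v) < q" for v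
    by (auto simp: R_def Z_def mem_box_cart forall_2)
  have RS: "Z v \<in> S" if "v \<in> R" for v
    using that sub[of "v$1" "v$2"] by (auto simp: memR Z_def)
  have der: "(g has_derivative g' v) (at v within R)" if "v \<in> R" for v
  proof -
    have "(H has_field_derivative deriv H (Z v)) (at (Z v))"
      using RS[OF that] \<open>open S\<close> holH holomorphic_derivI by blast
    then have "(H has_derivative (*) (deriv H (Z v))) (at (Z v))"
      by (simp add: has_field_derivative_def)
    moreover have "(Z has_derivative Z) (at v within R)"
      using linZ by (rule bounded_linear_imp_has_derivative)
    ultimately have "((\<lambda>v. H (Z v)) has_derivative (\<lambda>u. deriv H (Z v) * Z u)) (at v within R)"
      using has_derivative_compose by blast
    then show ?thesis
      unfolding g_def g'_def
      by (intro bounded_linear.has_derivative[OF linV] bounded_linear.has_derivative[OF linT])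
  qed
  have det: "det (matrix (g' v)) = (1 - (cmod c)\<^sup>2) * (cmod (deriv H (Z v)))\<^sup>2" for v
  proof -
    have Z1: "Z (axis 1 1) = 1" and Z2: "Z (axis 2 1) = \<i>"
      by (simp_all add: Z_def axis_def complex_eq_iff)
    show ?thesis
      unfolding det_2 matrix_def
      by (simp add: g'_def V_def T_def Z1 Z2 cmod_power2) algebra
  qed
  have injT: "T w = T w' \<longleftrightarrow> w = w'" for w w'
  proof
    assume "T w = T w'"
    then have "w - w' = c * cnj (w - w')"
      by (simp add: T_def algebra_simps)
    then have "cmod (w - w') = cmod c * cmod (w - w')"
      by (metis complex_mod_cnj norm_mult)
    then show "w = w'"
      using c by auto
  qed simp
  have injg: "inj_on g R"
  proof (rule inj_onI)
    fix u v assume uv: "u \<in> R" "v \<in> R" "g u = g v"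
    then have "T (H (Z u)) = T (H (Z v))"
      by (auto simp: g_def V_def vec_eq_iff forall_2 complex_eq_iff)
    then have "H (Z u) = H (Z v)"
      by (simp add: injT)
    then have "Z u = Z v"
      using inj uv(1,2) unfolding inj_on_def memR by blast
    then show "u = v"
      by (simp add: Z_def vec_eq_iff forall_2)
  qed
  have cont: "continuous_on (cbox (a, p) (b, q)) (\<lambda>t. (cmod (deriv H (Complex (fst t) (snd t))))\<^sup>2)"
  proof -
    have "continuous_on S (deriv H)"
      using \<open>open S\<close> holH holomorphic_deriv holomorphic_on_imp_continuous_on by blast
    moreover have "continuous_on (cbox (a, p) (b, q)) (\<lambda>t::real\<times>real. Complex (fst t) (snd t))"
      by (simp add: Complex_eq) (intro continuous_intros)
    ultimately have "continuous_on (cbox (a, p) (b, q)) (\<lambda>t. deriv H (Complex (fst t) (snd t)))"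
      by (rule continuous_on_compose2) (auto simp: cbox_Pair_eq sub)
    then show ?thesis
      by (intro continuous_intros)
  qed
  have "((\<lambda>t. (cmod (deriv H (Complex (fst t) (snd t))))\<^sup>2) has_integral I) (cbox (a, p) (b, q))"
    using integral_prod_continuous[OF cont] integrable_continuous[OF cont]
    unfolding I_def by (metis (no_types, lifting) cbox_interval fst_conv has_integral_integral integral_cong snd_conv)
  from has_integral_real2_from_product[OF this]
  have "((\<lambda>v. (1 - (cmod c)\<^sup>2) * (cmod (deriv H (Z v)))\<^sup>2) has_integral (1 - (cmod c)\<^sup>2) * I)
      (cbox (vector [a, p]) (vector [b, q]))"
    unfolding Z_def by (intro has_integral_mult_right) simp
  then have "((\<lambda>v. (1 - (cmod c)\<^sup>2) * (cmod (deriv H (Z v)))\<^sup>2) has_integral (1 - (cmod c)\<^sup>2) * I) R"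
    unfolding R_def by (simp add: has_integral_iff integrable_on_open_interval integral_open_interval)
  moreover have "(1 - (cmod c)\<^sup>2) * (cmod (deriv H (Z v)))\<^sup>2 \<ge> 0" for v
    using c by (simp add: power_le_one)
  ultimately have "((\<lambda>v. \<bar>det (matrix (g' v))\<bar>) has_integral (1 - (cmod c)\<^sup>2) * I) R"
    unfolding det by simp
  moreover have "R \<in> sets lebesgue"
    by (simp add: R_def)
  ultimately have img: "g ` R \<in> lmeasurable" "measure lebesgue (g ` R) = (1 - (cmod c)\<^sup>2) * I"
    using has_measure_differentiable_image[OF _ der injg] by blast+
  have "g ` R \<subseteq> cball 0 M"
  proof
    fix u assume "u \<in> g ` R"
    then obtain v where v: "v \<in> R" "u = g v" by blast
    have "norm (V w) = cmod w" for w
      by (simp add: norm_vec_def L2_set_def UNIV_2 V_def cmod_def)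
    then show "u \<in> cball 0 M"
      using v bd[of "Z v"] by (simp add: g_def memR T_def)
  qed
  then have "measure lebesgue (g ` R) \<le> measure lebesgue (cball (0::real^2) M)"
    by (rule measure_mono_fmeasurable) (use img fmeasurableD lmeasurable_cball in auto)
  also have "\<dots> = pi * M\<^sup>2"
    using M content_cball[of M "0::real^2"] by (simp add: unit_ball_vol_2)
  finally show ?thesis
    using img I_def by simp
qed

lemma mean_value_circle:
  assumes "\<Psi> holomorphic_on ball 0 1" and "0 < \<rho>" "\<rho> < 1"
  shows "((\<lambda>t. \<Psi> (of_real \<rho> * cis t)) has_integral 2 * of_real pi * \<Psi> 0) {0..2*pi}"
proof -
  have "\<Psi> holomorphic_on cball 0 \<rho>"
    using assms by (auto intro: holomorphic_on_subset)
  then have "((\<lambda>u. \<Psi> u / (u - 0)) has_contour_integral 2 * complex_of_real pi * \<i> * \<Psi> 0) (circlepath 0 \<rho>)"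
    by (rule Cauchy_integral_circlepath_simple) (use assms in auto)
  then have "((\<lambda>t. \<Psi> (of_real \<rho> * cis t) / (of_real \<rho> * cis t) * of_real \<rho> * \<i> * cis t)
      has_integral 2 * of_real pi * \<i> * \<Psi> 0) {0..2*pi}"
    unfolding circlepath_def by (subst (asm) has_contour_integral_part_circlepath_iff) auto
  then have "((\<lambda>t. \<i> * \<Psi> (of_real \<rho> * cis t)) has_integral \<i> * (2 * of_real pi * \<Psi> 0)) {0..2*pi}"
    using assms by (simp add: field_simps)
  from has_integral_mult_right[OF this, of "-\<i>"] show ?thesis
    by (simp flip: mult.assoc)
qed

text \<open>For \<open>k(z) = b z + b\<^sub>2 z\<^sup>2 + \<dots>\<close> Parseval's identity evaluates the right-hand side as a sum of
nonnegative terms, of which the two on the left are the first. Instead of a full Fourier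
expansion, the two terms are split off by hand: what remains besides a square is \<open>2 Re \<Psi>\<close> with
\<open>\<Psi>\<close> holomorphic and \<open>\<Psi> 0 = 0\<close>, and this has mean zero over the circle.\<close>

lemma ring_energy_lower_bound:
  assumes holk: "k holomorphic_on ball 0 1" and r: "0 < \<rho>" "\<rho> < 1"
  defines "E \<equiv> \<lambda>z. - 1 / z + z * deriv k z"
  shows "2 * pi * (1 / \<rho>\<^sup>2 + (cmod (deriv k 0))\<^sup>2 * \<rho>\<^sup>2)
           \<le> integral {0..2*pi} (\<lambda>t. (cmod (E (of_real \<rho> * cis t)))\<^sup>2)"
proof -
  define b where "b = deriv k 0"
  define \<Psi> where "\<Psi> = (\<lambda>z. - z\<^sup>2 * deriv k z / of_real (\<rho>\<^sup>2) + cnj b * of_real (\<rho>\<^sup>2) * (deriv k z - b))"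
  define L where "L = (\<lambda>t. (1 / \<rho>\<^sup>2 + (cmod b)\<^sup>2 * \<rho>\<^sup>2) + 2 * Re (\<Psi> (of_real \<rho> * cis t)))"
  have hold: "deriv k holomorphic_on ball 0 1"
    using holk by (intro holomorphic_deriv) auto
  have "\<Psi> holomorphic_on ball 0 1"
    unfolding \<Psi>_def using r by (intro holomorphic_intros hold) auto
  moreover have "\<Psi> 0 = 0"
    by (simp add: \<Psi>_def b_def)
  ultimately have "((\<lambda>t. \<Psi> (of_real \<rho> * cis t)) has_integral 0) {0..2*pi}"
    using mean_value_circle[of \<Psi> \<rho>] r by simp
  then have "((\<lambda>t. Re (\<Psi> (of_real \<rho> * cis t))) has_integral 0) {0..2*pi}"
    by (drule_tac has_integral_linear[OF _ bounded_linear_Re]) (simp add: o_def)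
  then have "((\<lambda>t. 2 * Re (\<Psi> (of_real \<rho> * cis t))) has_integral 2 * 0) {0..2*pi}"
    by (rule has_integral_mult_right)
  then have L: "(L has_integral ((1 / \<rho>\<^sup>2 + (cmod b)\<^sup>2 * \<rho>\<^sup>2) * (2 * pi) + 2 * 0)) {0..2*pi}"
    unfolding L_def using has_integral_const_real[of "1 / \<rho>\<^sup>2 + (cmod b)\<^sup>2 * \<rho>\<^sup>2" 0 "2*pi"]
    by (intro has_integral_add) (auto simp: mult.commute)
  have le: "L t \<le> (cmod (E (of_real \<rho> * cis t)))\<^sup>2" for t
  proof -
    define z where "z = of_real \<rho> * cis t"
    define j where "j = z * (deriv k z - b)"
    define n where "n = - 1 / z + b * z"
    have zz: "z * cnj z = of_real (\<rho>\<^sup>2)"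
      by (simp add: z_def power2_eq_square cis_cnj cis_mult)
    have z0: "z \<noteq> 0"
      using r by (simp add: z_def)
    \<comment> \<open>on the circle \<open>cnj z\<close> is a holomorphic function of \<open>z\<close>, which is what makes \<open>\<Psi>\<close> holomorphic\<close>
    have cz: "cnj z = of_real (\<rho>\<^sup>2) / z"
      using zz z0 by (simp add: field_simps)
    have "E z = n + j"
      by (simp add: E_def n_def j_def algebra_simps)
    then have "(cmod (E z))\<^sup>2 = (cmod n)\<^sup>2 + 2 * Re (j * cnj n) + (cmod j)\<^sup>2"
      unfolding cmod_power2 by (simp add: power2_eq_square algebra_simps)
    moreover have "(cmod n)\<^sup>2 = 1 / \<rho>\<^sup>2 + (cmod b)\<^sup>2 * \<rho>\<^sup>2 - 2 * Re (b * z\<^sup>2 / of_real (\<rho>\<^sup>2))"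
    proof -
      have "cmod (1 / z) = 1 / \<rho>" "cmod z = \<rho>"
        using r by (simp_all add: z_def norm_mult norm_divide)
      moreover have "(cmod n)\<^sup>2 = (cmod (1/z))\<^sup>2 + (cmod (b * z))\<^sup>2 - 2 * Re (b * z * cnj (1 / z))"
        unfolding cmod_power2 n_def by (simp del: complex_cnj_divide) algebra
      moreover have "b * z * cnj (1 / z) = b * z\<^sup>2 / of_real (\<rho>\<^sup>2)"
        using z0 r by (simp add: cz power2_eq_square field_simps)
      ultimately show ?thesis
        by (simp add: norm_mult power_divide power_mult_distrib)
    qed
    moreover have "j * cnj n - b * z\<^sup>2 / of_real (\<rho>\<^sup>2) = \<Psi> z"
      using z0 r by (simp add: \<Psi>_def j_def n_def cz power2_eq_square field_simps)
    then have "Re (j * cnj n) - Re (b * z\<^sup>2 / of_real (\<rho>\<^sup>2)) = Re (\<Psi> z)"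
      by (metis minus_complex.sel(1))
    moreover have "L t = (1 / \<rho>\<^sup>2 + (cmod b)\<^sup>2 * \<rho>\<^sup>2) + 2 * Re (\<Psi> z)"
      by (simp add: L_def z_def)
    ultimately have "L t \<le> (cmod (E z))\<^sup>2"
      using zero_le_power2[of "cmod j"] by argo
    then show ?thesis
      by (simp add: z_def)
  qed
  have "continuous_on {0..2*pi} (\<lambda>t. deriv k (of_real \<rho> * cis t))"
    by (rule continuous_on_compose2[OF holomorphic_on_imp_continuous_on[OF hold]])
       (use r in \<open>auto intro!: continuous_intros simp: norm_mult\<close>)
  then have "continuous_on {0..2*pi} (\<lambda>t. (cmod (E (of_real \<rho> * cis t)))\<^sup>2)"
    unfolding E_def using r by (intro continuous_intros) auto
  then have "(\<lambda>t. (cmod (E (of_real \<rho> * cis t)))\<^sup>2) integrable_on {0..2*pi}"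
    by (rule integrable_continuous_real)
  then have "integral {0..2*pi} L \<le> integral {0..2*pi} (\<lambda>t. (cmod (E (of_real \<rho> * cis t)))\<^sup>2)"
    using L le by (intro integral_le) auto
  with L show ?thesis
    by (simp add: b_def integral_unique mult.commute)
qed

text \<open>The points \<open>w\<close> with \<open>|w - c cnj w| > M\<close> form a connected set \<open>X\<close>, the exterior of an ellipse. It
avoids the image of the circle \<open>|z| = \<epsilon>\<close>, and it meets the image \<open>Y\<close> of the punctured disk
\<open>0 < |z| < \<epsilon>\<close>, which reaches to infinity. Hence \<open>X \<subseteq> Y\<close>, and by injectivity no point outside the
small disk is mapped into \<open>X\<close>.\<close>

lemma injective_pole_image_bounded:
  assumes holk: "k holomorphic_on ball 0 1"
    and inj: "inj_on (\<lambda>z. 1 / z + k z) (ball 0 1 - {0})"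
    and e: "0 < \<epsilon>" "\<epsilon> < 1" and c: "cmod c < 1"
    and bd: "\<And>z. cmod z = \<epsilon> \<Longrightarrow> cmod ((1 / z + k z) - c * cnj (1 / z + k z)) \<le> M"
    and z: "\<epsilon> < cmod z" "cmod z < 1"
  shows "cmod ((1 / z + k z) - c * cnj (1 / z + k z)) \<le> M"
proof (rule ccontr)
  assume neg: "\<not> ?thesis"
  define G where "G = (\<lambda>z. 1 / z + k z)"
  define T where "T = (\<lambda>w. w - c * cnj w)"
  define Y where "Y = G ` (ball 0 \<epsilon> - {0})"
  define X where "X = {w. M < cmod (T w)}"
  have contk: "continuous_on (ball 0 1) k"
    using holk holomorphic_on_imp_continuous_on by blast
  have "0 \<le> M"
    by (rule order_trans[OF norm_ge_zero bd[of "of_real \<epsilon>"]]) (use e in simp)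
  define s where "s = complex_of_real (1 - (cmod c)\<^sup>2)"
  have "1 - (cmod c)\<^sup>2 \<noteq> 0"
    using c by (smt (verit) norm_ge_zero power2_eq_1_iff)
  then have s0: "s \<noteq> 0"
    by (simp add: s_def del: of_real_diff)
  have Tinv: "T ((w + c * cnj w) / s) = w" for w
  proof -
    have "T (w + c * cnj w) = s * w"
      by (simp add: s_def T_def algebra_simps complex_norm_square[symmetric])
    moreover have "T (w / s) = T w / s" for w
      by (simp add: s_def T_def diff_divide_distrib)
    ultimately show ?thesis
      using s0 by simp
  qed
  have Tinv': "(T w + c * cnj (T w)) / s = w" for w
  proof -
    have "T w + c * cnj (T w) = s * w"
      by (simp add: s_def T_def algebra_simps complex_norm_square[symmetric])
    then show ?thesis
      using s0 by simp
  qed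
  have X_eq: "X = (\<lambda>w. (w + c * cnj w) / s) ` (- cball 0 M)"
  proof (intro equalityI subsetI)
    fix w assume "w \<in> X"
    then show "w \<in> (\<lambda>w. (w + c * cnj w) / s) ` (- cball 0 M)"
      using Tinv'[of w] by (intro image_eqI[of _ _ "T w"]) (auto simp: X_def)
  qed (auto simp: X_def Tinv)
  have "connected (- cball (0::complex) M)"
    by (rule connected_complement_bounded_convex) auto
  then have "connected X"
    unfolding X_eq
    by (rule connected_continuous_image[rotated]) (intro continuous_intros, use s0 in auto)
  have "open Y"
  proof -
    have "G holomorphic_on (ball 0 \<epsilon> - {0})"
      unfolding G_def by (intro holomorphic_intros holomorphic_on_subset[OF holk]) (use e in auto)
    moreover have "inj_on G (ball 0 \<epsilon> - {0})"
      unfolding G_def by (rule inj_on_subset[OF inj]) (use e in auto)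
    ultimately show ?thesis
      unfolding Y_def by (intro open_mapping_thm3) auto
  qed
  have frontier: "frontier Y \<subseteq> G ` sphere 0 \<epsilon>"
  proof
    fix w assume w: "w \<in> frontier Y"
    then have "w \<in> closure Y" "w \<notin> Y"
      using \<open>open Y\<close> by (auto simp: frontier_def interior_open)
    then obtain x where x: "\<And>n. x n \<in> Y" "x \<longlonglongrightarrow> w"
      using closure_sequential by metis
    then have "\<exists>u. \<forall>n. u n \<in> ball 0 \<epsilon> - {0} \<and> x n = G (u n)"
      unfolding Y_def image_iff by metis
    then obtain u where u: "\<And>n. u n \<in> ball 0 \<epsilon> - {0}" "\<And>n. x n = G (u n)"
      by blast
    have "\<And>n. u n \<in> cball 0 \<epsilon>"
      using u(1) by (auto simp: less_imp_le)
    then obtain l s where l: "l \<in> cball 0 \<epsilon>" "strict_mono s" "(u \<circ> s) \<longlonglongrightarrow> l"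
      using compact_cball[of 0 \<epsilon>, unfolded compact_def] by metis
    have lb: "l \<in> ball 0 1"
      using l(1) e by auto
    have ub: "u n \<in> ball 0 1" for n
      using u(1)[of n] e by auto
    have ks: "(\<lambda>n. k (u (s n))) \<longlonglongrightarrow> k l"
      using continuous_on_tendsto_compose[OF contk l(3) lb] ub by (simp add: o_def)
    have xs: "(\<lambda>n. G (u (s n))) \<longlonglongrightarrow> w"
      using LIMSEQ_subseq_LIMSEQ[OF x(2) l(2)] by (simp add: o_def u(2))
    have "l \<noteq> 0"
    proof
      assume "l = 0"
      \<comment> \<open>\<open>u * G u - u * k u = 1\<close> persists in the limit, although \<open>G u\<close> stays bounded\<close>
      have "(\<lambda>n. u (s n) * G (u (s n)) - u (s n) * k (u (s n))) \<longlonglongrightarrow> 0 * w - 0 * k l"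
        using l(3) \<open>l = 0\<close> by (intro tendsto_intros ks xs) (auto simp: o_def)
      moreover have "u n * G (u n) - u n * k (u n) = 1" for n
        using u(1)[of n] by (simp add: G_def field_simps)
      ultimately show False
        by (simp add: LIMSEQ_const_iff)
    qed
    have "(\<lambda>n. 1 / u (s n) + k (u (s n))) \<longlonglongrightarrow> 1 / l + k l"
      using l(3) \<open>l \<noteq> 0\<close> by (intro tendsto_intros ks) (auto simp: o_def)
    then have "w = G l"
      using xs LIMSEQ_unique unfolding G_def by blast
    with \<open>w \<notin> Y\<close> \<open>l \<noteq> 0\<close> have "l \<notin> ball 0 \<epsilon>"
      by (auto simp: Y_def)
    with l(1) \<open>w = G l\<close> show "w \<in> G ` sphere 0 \<epsilon>"
      by auto
  qed
  have "X \<inter> frontier Y = {}"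
    using frontier bd unfolding X_def T_def G_def by force
  moreover have "X \<inter> Y \<noteq> {}"
  proof -
    define x where "x = (\<lambda>n. complex_of_real (\<epsilon> / real (n + 2)))"
    have xb: "x n \<in> ball 0 \<epsilon> - {0}" for n
    proof -
      have "0 < \<epsilon> / real (n + 2)" "\<epsilon> / real (n + 2) < \<epsilon>"
        using e by (auto simp: divide_simps)
      then show ?thesis
        unfolding x_def by (simp del: of_real_divide of_nat_add)
    qed
    have "x \<longlonglongrightarrow> of_real 0"
      unfolding x_def by (intro tendsto_of_real) real_asymp
    then have lim0: "x \<longlonglongrightarrow> 0"
      by simp
    then have "filterlim x (at 0) sequentially"
      using xb by (auto simp: filterlim_at)
    then have "filterlim (\<lambda>n. inverse (x n)) at_infinity sequentially"
      by (rule filterlim_compose[OF filterlim_inverse_at_infinity])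
    moreover have "x n \<in> ball 0 1" for n
      using xb[of n] e by auto
    then have "(\<lambda>n. k (x n)) \<longlonglongrightarrow> k 0"
      using continuous_on_tendsto_compose[OF contk lim0] by simp
    ultimately have "filterlim (\<lambda>n. k (x n) + inverse (x n)) at_infinity sequentially"
      by (intro tendsto_add_filterlim_at_infinity)
    then have G: "filterlim (\<lambda>n. norm (G (x n))) at_top sequentially"
      by (simp add: G_def add.commute inverse_eq_divide filterlim_at_infinity_conv_norm_at_top)
    have "filterlim (\<lambda>n. (1 - cmod c) * norm (G (x n))) at_top sequentially"
      using c G by (intro filterlim_tendsto_pos_mult_at_top[OF tendsto_const]) auto
    then have "\<forall>\<^sub>F n in sequentially. M < (1 - cmod c) * norm (G (x n))"
      unfolding filterlim_at_top_dense by blast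
    then obtain n where n: "M < (1 - cmod c) * norm (G (x n))"
      by (auto simp: eventually_sequentially)
    also have "(1 - cmod c) * cmod (G (x n)) \<le> cmod (T (G (x n)))"
      using norm_triangle_ineq2[of "G (x n)" "c * cnj (G (x n))"]
      by (simp add: T_def norm_mult algebra_simps)
    finally show ?thesis
      using xb[of n] unfolding X_def Y_def by blast
  qed
  ultimately have "X \<subseteq> Y"
    using connected_Int_frontier[OF \<open>connected X\<close>] by blast
  moreover have "G z \<in> X"
    using neg by (simp add: X_def T_def G_def)
  ultimately obtain u where "u \<in> ball 0 \<epsilon> - {0}" "G z = G u"
    unfolding Y_def by blast
  then have "z = u"
    unfolding G_def by (intro inj_onD[OF inj, of z u]) (use z e in auto)
  with \<open>u \<in> ball 0 \<epsilon> - {0}\<close> z show False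
    by auto
qed

lemma exp_twice_real:
  fixes x :: real
  shows "exp (2 * x) = (exp x)\<^sup>2" "exp (- 2 * x) = 1 / (exp x)\<^sup>2"
  by (simp_all add: exp_double[symmetric] exp_minus[symmetric] divide_inverse)

lemma quadratic_remainder_bound:
  assumes holk: "k holomorphic_on ball 0 1" and k0: "k 0 = 0"
  obtains C where "0 \<le> C" "\<And>z. cmod z \<le> 1/2 \<Longrightarrow> cmod (k z - deriv k 0 * z) \<le> C * (cmod z)\<^sup>2"
proof -
  define k1 where "k1 = (\<lambda>z. if z = 0 then deriv k 0 else (k z - k 0) / (z - 0))"
  define k2 where "k2 = (\<lambda>z. if z = 0 then deriv k1 0 else (k1 z - k1 0) / (z - 0))"
  have "k1 holomorphic_on ball 0 1"
    unfolding k1_def by (rule pole_lemma_open[OF holk]) auto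
  then have "k2 holomorphic_on ball 0 1"
    unfolding k2_def by (rule pole_lemma_open) auto
  then have "continuous_on (ball 0 1) k2"
    by (rule holomorphic_on_imp_continuous_on)
  then have "continuous_on (cball 0 (1/2)) k2"
    by (rule continuous_on_subset) auto
  then have "bounded (k2 ` cball 0 (1/2))"
    by (intro compact_imp_bounded compact_continuous_image) auto
  then obtain C where C: "0 < C" "\<And>z. cmod z \<le> 1/2 \<Longrightarrow> cmod (k2 z) \<le> C"
    unfolding bounded_pos by auto
  have eq: "k z - deriv k 0 * z = k2 z * z\<^sup>2" for z
    by (auto simp: k2_def k1_def k0 field_simps power2_eq_square)
  show ?thesis
  proof (rule that)
    show "cmod (k z - deriv k 0 * z) \<le> C * (cmod z)\<^sup>2" if "cmod z \<le> 1/2" for z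
      unfolding eq norm_mult norm_power using C(2)[OF that] by (intro mult_right_mono) auto
  qed (use C(1) in simp)
qed

text \<open>The left-hand side is a lower bound for the area of the twisted image of the annulus
\<open>\<epsilon> < |z| < r\<close>, divided by \<open>\<pi>\<close>. In the coordinate \<open>log z\<close> the annulus becomes a rectangle, so the
area is an iterated integral whose inner integral runs over a circle.\<close>

lemma annulus_area_inequality:
  assumes holk: "k holomorphic_on ball 0 1"
    and inj: "inj_on (\<lambda>z. 1 / z + k z) (ball 0 1 - {0})"
    and e: "0 < \<epsilon>" "\<epsilon> < r" "r < 1" and c: "cmod c < 1"
    and bd: "\<And>z. cmod z = \<epsilon> \<Longrightarrow> cmod ((1 / z + k z) - c * cnj (1 / z + k z)) \<le> M"
  shows "(1 - (cmod c)\<^sup>2) * ((1 / \<epsilon>\<^sup>2 - 1 / r\<^sup>2) + (cmod (deriv k 0))\<^sup>2 * (r\<^sup>2 - \<epsilon>\<^sup>2)) \<le> M\<^sup>2"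
proof -
  define S where "S = {z. Re z < 0}"
  define H where "H = (\<lambda>z. 1 / exp z + k (exp z))"
  define B where "B = (cmod (deriv k 0))\<^sup>2"
  define E where "E = (\<lambda>z. - 1 / z + z * deriv k z)"
  define J where "J = (\<lambda>x. integral {0..2*pi} (\<lambda>y. (cmod (deriv H (Complex x y)))\<^sup>2))"
  have "0 \<le> M"
    by (rule order_trans[OF norm_ge_zero bd[of "of_real \<epsilon>"]]) (use e in simp)
  have "open S"
    by (simp add: S_def open_halfspace_Re_lt)
  have holH: "H holomorphic_on S"
  proof -
    have "(k \<circ> exp) holomorphic_on S"
      by (rule holomorphic_on_compose_gen[OF _ holk]) (auto intro: holomorphic_intros simp: S_def)
    then show ?thesis
      unfolding H_def by (auto intro!: holomorphic_intros simp: o_def)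
  qed
  have derH: "deriv H z = E (exp z)" if "z \<in> S" for z
  proof -
    have "(k has_field_derivative deriv k (exp z)) (at (exp z))"
      using that by (intro holomorphic_derivI[OF holk]) (auto simp: S_def)
    then have "((\<lambda>z. k (exp z)) has_field_derivative deriv k (exp z) * exp z) (at z)"
      by (rule DERIV_chain2) (auto intro: derivative_intros)
    then have "(H has_field_derivative E (exp z)) (at z)"
      unfolding H_def E_def
      by (auto intro!: derivative_eq_intros simp: field_simps power2_eq_square)
    then show ?thesis
      by (rule DERIV_imp_deriv)
  qed
  have lnS: "Complex x y \<in> S" if "x \<le> ln r" for x y
    using that e by (auto simp: S_def) (smt (verit) ln_less_zero)
  have area: "(1 - (cmod c)\<^sup>2) * integral {ln \<epsilon>..ln r} J \<le> pi * M\<^sup>2"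
    unfolding J_def
  proof (rule area_twisted_image_le[OF \<open>open S\<close> holH _ _ c \<open>0 \<le> M\<close>])
    show "inj_on H {z. ln \<epsilon> < Re z \<and> Re z < ln r \<and> 0 < Im z \<and> Im z < 2 * pi}"
    proof (rule inj_onI)
      fix u v assume u: "u \<in> {z. ln \<epsilon> < Re z \<and> Re z < ln r \<and> 0 < Im z \<and> Im z < 2 * pi}"
        and v: "v \<in> {z. ln \<epsilon> < Re z \<and> Re z < ln r \<and> 0 < Im z \<and> Im z < 2 * pi}"
        and eq: "H u = H v"
      have "Re u < 0" "Re v < 0"
        using u v e ln_less_zero[of r] by (auto simp del: ln_less_zero_iff)
      then have "exp u \<in> ball 0 1 - {0}" "exp v \<in> ball 0 1 - {0}"
        by auto
      then have "exp u = exp v"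
        using inj eq unfolding inj_on_def H_def by blast
      moreover have "\<bar>Im u - Im v\<bar> < 2 * pi"
        using u v unfolding mem_Collect_eq by linarith
      ultimately show "u = v"
        by (rule exp_complex_eqI[rotated])
    qed
    fix z assume z: "ln \<epsilon> < Re z" "Re z < ln r"
    have "\<epsilon> < cmod (exp z)" "cmod (exp z) < r"
      using z e exp_less_mono[of "ln \<epsilon>" "Re z"] exp_less_mono[of "Re z" "ln r"]
      by (simp_all add: norm_exp_eq_Re)
    then show "cmod (H z - c * cnj (H z)) \<le> M"
      unfolding H_def using e
      by (intro injective_pole_image_bounded[OF holk inj e(1) _ c bd]; linarith)
  qed (use lnS in auto)
  have lower: "2 * pi * (exp (-2 * x) + B * exp (2 * x)) \<le> J x" if "x \<le> ln r" for x
  proof -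
    have "x < 0"
      using that e by (smt (verit) ln_less_zero)
    have "exp (Complex x y) = of_real (exp x) * cis y" for y
      by (simp add: exp_eq_polar)
    then have "J x = integral {0..2*pi} (\<lambda>t. (cmod (E (of_real (exp x) * cis t)))\<^sup>2)"
      using derH lnS[OF that] unfolding J_def by simp
    moreover have "2 * pi * (1 / (exp x)\<^sup>2 + B * (exp x)\<^sup>2) \<le> \<dots>"
      unfolding E_def B_def by (rule ring_energy_lower_bound[OF holk]) (use \<open>x < 0\<close> in auto)
    ultimately show ?thesis
      unfolding exp_twice_real by simp
  qed
  have "continuous_on (cbox (ln \<epsilon>, 0) (ln r, 2*pi)) (\<lambda>(x, y). (cmod (deriv H (Complex x y)))\<^sup>2)"
  proof -
    have "continuous_on S (deriv H)"
      using \<open>open S\<close> holH holomorphic_deriv holomorphic_on_imp_continuous_on by blast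
    moreover have "continuous_on (cbox (ln \<epsilon>, 0) (ln r, 2*pi)) (\<lambda>t::real\<times>real. Complex (fst t) (snd t))"
      by (simp add: Complex_eq) (intro continuous_intros)
    ultimately have "continuous_on (cbox (ln \<epsilon>, 0) (ln r, 2*pi)) (\<lambda>t. deriv H (Complex (fst t) (snd t)))"
      by (rule continuous_on_compose2) (use lnS in \<open>auto simp: cbox_Pair_eq\<close>)
    then show ?thesis
      by (auto simp: case_prod_unfold intro!: continuous_intros)
  qed
  from integral_integrable_2dim[OF this] have "J integrable_on {ln \<epsilon>..ln r}"
    by (simp add: J_def)
  moreover have int: "((\<lambda>x. 2 * pi * (exp (-2 * x) + B * exp (2 * x))) has_integral
      pi * (- exp (-2 * ln r) + B * exp (2 * ln r)) - pi * (- exp (-2 * ln \<epsilon>) + B * exp (2 * ln \<epsilon>)))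
      {ln \<epsilon>..ln r}"
    using e
    by (intro fundamental_theorem_of_calculus)
       (auto intro!: derivative_eq_intros simp: field_simps
             simp flip: has_real_derivative_iff_has_vector_derivative)
  ultimately have "pi * (- exp (-2 * ln r) + B * exp (2 * ln r)) - pi * (- exp (-2 * ln \<epsilon>) + B * exp (2 * ln \<epsilon>))
      \<le> integral {ln \<epsilon>..ln r} J"
    using lower by (metis (no_types, lifting) atLeastAtMost_iff has_integral_le integrable_integral)
  moreover have "exp (2 * ln x) = x\<^sup>2" "exp (-2 * ln x) = 1 / x\<^sup>2" if "0 < x" for x :: real
    using that unfolding exp_twice_real by simp_all
  ultimately have "pi * ((1 / \<epsilon>\<^sup>2 - 1 / r\<^sup>2) + B * (r\<^sup>2 - \<epsilon>\<^sup>2)) \<le> integral {ln \<epsilon>..ln r} J"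
    using e by (simp add: algebra_simps)
  moreover have "0 \<le> 1 - (cmod c)\<^sup>2"
    using c by (simp add: power_le_one)
  ultimately have "(1 - (cmod c)\<^sup>2) * (pi * ((1 / \<epsilon>\<^sup>2 - 1 / r\<^sup>2) + B * (r\<^sup>2 - \<epsilon>\<^sup>2))) \<le> pi * M\<^sup>2"
    using area mult_left_mono order_trans by meson
  then have "pi * ((1 - (cmod c)\<^sup>2) * ((1 / \<epsilon>\<^sup>2 - 1 / r\<^sup>2) + B * (r\<^sup>2 - \<epsilon>\<^sup>2))) \<le> pi * M\<^sup>2"
    by (simp add: mult_ac)
  then show ?thesis
    by (simp add: B_def)
qed

text \<open>Gronwall's area theorem says \<open>\<Sum> n |b\<^sub>n|\<^sup>2 \<le> 1\<close> for the coefficients of \<open>k\<close>; this is its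
consequence for \<open>b\<^sub>1\<close>. The image of the circle \<open>|z| = \<epsilon>\<close> is an ellipse with semi-axes
\<open>1/\<epsilon> \<plusminus> |b\<^sub>1| \<epsilon>\<close> up to an error of order \<open>\<epsilon>\<^sup>2\<close>. Enclosing it in a disk would overestimate its area
by a quantity that does not vanish with \<open>\<epsilon>\<close>; the twist with \<open>c = b\<^sub>1 \<epsilon>\<^sup>2\<close> makes it a circle up to that
error, and the inequality for annuli becomes sharp as \<open>\<epsilon> \<rightarrow> 0\<close> and \<open>r \<rightarrow> 1\<close>.\<close>

theorem area_theorem_linear_coefficient:
  assumes holk: "k holomorphic_on ball 0 1" and k0: "k 0 = 0"
    and inj: "inj_on (\<lambda>z. 1 / z + k z) (ball 0 1 - {0})"
  shows "cmod (deriv k 0) \<le> 1"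
proof -
  define b where "b = deriv k 0"
  obtain C where C: "0 \<le> C" "\<And>z. cmod z \<le> 1/2 \<Longrightarrow> cmod (k z - b * z) \<le> C * (cmod z)\<^sup>2"
    unfolding b_def using quadratic_remainder_bound[OF holk k0] by metis
  define C' where "C' = C + cmod b * (cmod b + C)"
  have main: "(1 - (cmod b)\<^sup>2 * \<epsilon>^4) * ((1 / \<epsilon>\<^sup>2 - 1 / r\<^sup>2) + (cmod b)\<^sup>2 * (r\<^sup>2 - \<epsilon>\<^sup>2)) \<le> (1 / \<epsilon> + C' * \<epsilon>\<^sup>2)\<^sup>2"
    if e: "0 < \<epsilon>" "\<epsilon> < r" "\<epsilon> < 1/2" "cmod b * \<epsilon>\<^sup>2 < 1" and r: "r < 1" for \<epsilon> r
  proof -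
    define c where "c = of_real (\<epsilon>\<^sup>2) * b"
    have c: "cmod c = cmod b * \<epsilon>\<^sup>2"
      by (simp add: c_def norm_mult norm_power)
    have "cmod ((1 / z + k z) - c * cnj (1 / z + k z)) \<le> 1 / \<epsilon> + C' * \<epsilon>\<^sup>2" if z: "cmod z = \<epsilon>" for z
    proof -
      have "z \<noteq> 0" using z e by auto
      have "z * cnj z = of_real (\<epsilon>\<^sup>2)"
        using complex_norm_square[of z] z by simp
      then have "c * cnj (1 / z) = b * z"
        using \<open>z \<noteq> 0\<close> by (simp add: c_def field_simps)
      then have eq: "(1 / z + k z) - c * cnj (1 / z + k z) = 1 / z + (k z - b * z) - c * cnj (k z)"
        by (simp add: algebra_simps)
      have k1: "cmod (k z - b * z) \<le> C * \<epsilon>\<^sup>2"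
        using C(2)[of z] z e by simp
      have "cmod (k z) \<le> cmod (k z - b * z) + cmod (b * z)"
        using norm_triangle_ineq[of "k z - b * z" "b * z"] by simp
      also have "\<dots> \<le> C * \<epsilon>\<^sup>2 + cmod b * \<epsilon>"
        using k1 z by (simp add: norm_mult)
      also have "\<dots> \<le> C * 1 + cmod b * 1"
        using e C(1) by (intro add_mono mult_left_mono) (auto simp: power_le_one)
      finally have k2: "cmod (k z) \<le> cmod b + C"
        by simp
      have "cmod (1 / z + (k z - b * z) - c * cnj (k z)) \<le> cmod (1 / z) + cmod (k z - b * z) + cmod (c * cnj (k z))"
        using norm_triangle_ineq4 norm_triangle_ineq order_trans add_right_mono by meson
      also have "\<dots> \<le> 1 / \<epsilon> + C * \<epsilon>\<^sup>2 + (cmod b * \<epsilon>\<^sup>2) * (cmod b + C)"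
        using k1 k2 z by (intro add_mono) (auto simp: norm_mult norm_divide c intro!: mult_left_mono)
      also have "\<dots> = 1 / \<epsilon> + C' * \<epsilon>\<^sup>2"
        by (simp add: C'_def algebra_simps)
      finally show ?thesis
        unfolding eq .
    qed
    from annulus_area_inequality[OF holk inj e(1,2) r _ this]
    show ?thesis
      using c e by (simp add: b_def power_mult_distrib)
  qed
  have bound: "(cmod b)\<^sup>2 * r\<^sup>2 \<le> 1 / r\<^sup>2" if r: "0 < r" "r < 1" for r
  proof -
    define \<beta> where "\<beta> = cmod b"
    have "((\<lambda>\<epsilon>. (1 - \<beta>\<^sup>2 * \<epsilon>^4) * ((1 / \<epsilon>\<^sup>2 - 1 / r\<^sup>2) + \<beta>\<^sup>2 * (r\<^sup>2 - \<epsilon>\<^sup>2)) - (1 / \<epsilon> + C' * \<epsilon>\<^sup>2)\<^sup>2)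
        \<longlongrightarrow> \<beta>\<^sup>2 * r\<^sup>2 - 1 / r\<^sup>2) (at_right 0)"
      using r by real_asymp
    moreover have "\<forall>\<^sub>F \<epsilon> in at_right 0. (1 - \<beta>\<^sup>2 * \<epsilon>^4) * ((1 / \<epsilon>\<^sup>2 - 1 / r\<^sup>2) + \<beta>\<^sup>2 * (r\<^sup>2 - \<epsilon>\<^sup>2)) - (1 / \<epsilon> + C' * \<epsilon>\<^sup>2)\<^sup>2 \<le> 0"
    proof -
      have 1: "\<forall>\<^sub>F \<epsilon> in at_right (0::real). 0 < \<epsilon> \<and> \<epsilon> < min r (1/2)"
        using r by (intro eventually_at_rightI[of 0 "min r (1/2)"]) auto
      have "((\<lambda>\<epsilon>. \<beta> * \<epsilon>\<^sup>2) \<longlongrightarrow> \<beta> * 0\<^sup>2) (at_right 0)"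
        by (intro tendsto_intros)
      then have 2: "\<forall>\<^sub>F \<epsilon> in at_right 0. \<beta> * \<epsilon>\<^sup>2 < 1"
        by (rule order_tendstoD) auto
      from 1 2 show ?thesis
        by eventually_elim (use main[of _ r] r in \<open>auto simp: \<beta>_def\<close>)
    qed
    ultimately have "\<beta>\<^sup>2 * r\<^sup>2 - 1 / r\<^sup>2 \<le> 0"
      by (rule tendsto_upperbound) auto
    then show ?thesis
      by (simp add: \<beta>_def)
  qed
  show ?thesis
  proof (rule field_le_mult_one_interval)
    fix s :: real assume s: "0 < s" "s < 1"
    have "(cmod b)\<^sup>2 * (sqrt s)\<^sup>2 \<le> 1 / (sqrt s)\<^sup>2"
      using s by (intro bound) auto
    then have "(s * cmod b)\<^sup>2 \<le> 1\<^sup>2"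
      using s by (simp add: field_simps power2_eq_square)
    then show "s * cmod (deriv k 0) \<le> 1"
      unfolding b_def by (rule power2_le_imp_le) simp
  qed
qed

section \<open>Univalent functions\<close>

text \<open>Normalise \<open>F(z) = F(0) + D z (1 + a\<^sub>2 z + \<dots>)\<close>. The square root transform
\<open>\<phi>(z) = z q(z\<^sup>2)\<close> with \<open>F(z\<^sup>2) = F(0) + D \<phi>(z)\<^sup>2\<close> is again injective, and
\<open>1/\<phi>(z) = 1/z - (a\<^sub>2/2) z + \<dots>\<close>, so the area theorem gives \<open>|a\<^sub>2| \<le> 2\<close>.\<close>

theorem bieberbach_second_coefficient:
  assumes holF: "F holomorphic_on ball 0 1" and inj: "inj_on F (ball 0 1)"
  shows "cmod (deriv (deriv F) 0) \<le> 4 * cmod (deriv F 0)"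
proof -
  define D where "D = deriv F 0"
  have D0: "D \<noteq> 0"
    unfolding D_def by (rule holomorphic_injective_imp_regular[OF holF _ inj]) auto
  define p where "p = (\<lambda>z. if z = 0 then deriv F 0 else (F z - F 0) / (z - 0))"
  have holp: "p holomorphic_on ball 0 1"
    unfolding p_def by (rule pole_lemma_open[OF holF]) auto
  have Fp: "F z = F 0 + z * p z" for z
    by (simp add: p_def)
  have p0: "p z \<noteq> 0" if "z \<in> ball 0 1" for z
    using that D0 inj_onD[OF inj, of z 0] by (auto simp: p_def D_def)
  have "contractible (ball (0::complex) 1)"
    by (intro convex_imp_contractible) auto
  then obtain l where holl: "l holomorphic_on ball 0 1" and l: "\<And>z. z \<in> ball 0 1 \<Longrightarrow> p z = exp (l z)"
    using contractible_imp_holomorphic_log[OF holp _ p0] by metis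
  define q where "q = (\<lambda>z. exp ((l z - l 0) / 2))"
  have holq: "q holomorphic_on ball 0 1"
    unfolding q_def by (intro holomorphic_intros holl) auto
  have q0: "q 0 = 1" and qn0: "q z \<noteq> 0" for z
    by (auto simp: q_def)
  have pq: "p z = D * (q z)\<^sup>2" if "z \<in> ball 0 1" for z
  proof -
    have "(q z)\<^sup>2 = exp (l z - l 0)"
      by (simp add: q_def power2_eq_square flip: exp_add)
    also have "\<dots> = p z / p 0"
      using that l by (simp add: exp_diff)
    finally show ?thesis
      using D0 by (simp add: p_def D_def)
  qed
  have derp: "deriv (deriv F) 0 = 2 * deriv p 0"
  proof -
    have "deriv F z = p z + z * deriv p z" if "z \<in> ball 0 1" for z
    proof -
      have "((\<lambda>z. F 0 + z * p z) has_field_derivative p z + z * deriv p z) (at z)"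
        using that by (auto intro!: derivative_eq_intros holomorphic_derivI[OF holp])
      then show ?thesis
        using Fp by (metis (mono_tags, lifting) DERIV_cong_ev DERIV_imp_deriv eventuallyI)
    qed
    then have "\<forall>\<^sub>F z in nhds 0. deriv F z = p z + z * deriv p z"
      by (intro eventually_nhds_in_open[of "ball 0 1", THEN eventually_mono]) auto
    then have "deriv (deriv F) 0 = deriv (\<lambda>z. p z + z * deriv p z) 0"
      by (rule deriv_cong_ev) auto
    also have "\<dots> = 2 * deriv p 0"
      by (rule DERIV_imp_deriv)
         (auto intro!: derivative_eq_intros holomorphic_derivI[OF holp]
            holomorphic_derivI[OF holomorphic_deriv[OF holp]])
    finally show ?thesis .
  qed
  have derp': "deriv p 0 = 2 * D * deriv q 0"
  proof -
    have "\<forall>\<^sub>F z in nhds 0. p z = D * (q z)\<^sup>2"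
      using pq by (intro eventually_nhds_in_open[of "ball 0 1", THEN eventually_mono]) auto
    then have "deriv p 0 = deriv (\<lambda>z. D * (q z)\<^sup>2) 0"
      by (rule deriv_cong_ev) auto
    also have "\<dots> = 2 * D * deriv q 0"
      by (rule DERIV_imp_deriv)
         (auto intro!: derivative_eq_intros holomorphic_derivI[OF holq] simp: q0)
    finally show ?thesis .
  qed
  \<comment> \<open>\<open>k\<close> is \<open>1 / \<phi>(z) - 1 / z\<close>, written without the removable singularity at \<open>0\<close>\<close>
  define m where "m = (\<lambda>z. if z = 0 then deriv q 0 else (q z - q 0) / (z - 0))"
  have holm: "m holomorphic_on ball 0 1"
    unfolding m_def by (rule pole_lemma_open[OF holq]) auto
  have qm: "q z = 1 + z * m z" for z
    by (simp add: m_def q0)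
  define N where "N = (\<lambda>z. - m (z\<^sup>2) / q (z\<^sup>2))"
  define k where "k = (\<lambda>z. z * N z)"
  have sq: "z\<^sup>2 \<in> ball 0 1" if "z \<in> ball 0 1" for z :: complex
    using that by (simp add: norm_power power_less_one_iff)
  have holN: "N holomorphic_on ball 0 1"
  proof -
    have "(m \<circ> (\<lambda>z. z\<^sup>2)) holomorphic_on ball 0 1" "(q \<circ> (\<lambda>z. z\<^sup>2)) holomorphic_on ball 0 1"
      by (rule holomorphic_on_compose_gen[OF _ holm], auto intro!: holomorphic_intros simp: sq[simplified])
         (rule holomorphic_on_compose_gen[OF _ holq], auto intro!: holomorphic_intros simp: sq[simplified])
    then show ?thesis
      unfolding N_def by (auto intro!: holomorphic_intros simp: o_def qn0)
  qed
  have holk: "k holomorphic_on ball 0 1"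
    unfolding k_def by (intro holomorphic_intros holN)
  have G: "1 / z + k z = 1 / (z * q (z\<^sup>2))" if "z \<noteq> 0" for z
    using that qm[of "z\<^sup>2"] qn0[of "z\<^sup>2"] by (simp add: k_def N_def field_simps power2_eq_square)
  have "inj_on (\<lambda>z. 1 / z + k z) (ball 0 1 - {0})"
  proof (rule inj_onI)
    fix z u assume z: "z \<in> ball (0::complex) 1 - {0}" and u: "u \<in> ball (0::complex) 1 - {0}"
      and "1 / z + k z = 1 / u + k u"
    then have "1 / (z * q (z\<^sup>2)) = 1 / (u * q (u\<^sup>2))"
      using G[of z] G[of u] z u by simp
    then have eq: "z * q (z\<^sup>2) = u * q (u\<^sup>2)"
      by simp
    have "F (x\<^sup>2) = F 0 + D * (x * q (x\<^sup>2))\<^sup>2" if "x \<in> ball 0 1" for x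
      using Fp[of "x\<^sup>2"] pq[OF sq[OF that]] by (simp add: power_mult_distrib)
    then have "F (z\<^sup>2) = F (u\<^sup>2)"
      using z u eq by simp
    then have sqeq: "z\<^sup>2 = u\<^sup>2"
      using inj_onD[OF inj _ sq sq] z u by blast
    then have "z * q (z\<^sup>2) = u * q (z\<^sup>2)"
      using eq by simp
    then show "z = u"
      using qn0 by simp
  qed
  then have "cmod (deriv k 0) \<le> 1"
    by (intro area_theorem_linear_coefficient[OF holk]) (auto simp: k_def)
  moreover have "deriv k 0 = N 0"
    unfolding k_def by (rule DERIV_imp_deriv) (auto intro!: derivative_eq_intros holomorphic_derivI[OF holN])
  moreover have "N 0 = - deriv q 0"
    by (simp add: N_def m_def q0)
  ultimately show ?thesis
    unfolding derp derp' by (simp add: norm_mult D_def mult_left_le)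
qed

text \<open>Bieberbach's inequality for \<open>F\<close> composed with the automorphism of the disk that takes \<open>0\<close>
to \<open>\<zeta>\<close>.\<close>

lemma koebe_second_derivative:
  assumes holF: "F holomorphic_on ball 0 1" and inj: "inj_on F (ball 0 1)" and \<zeta>: "cmod \<zeta> < 1"
  shows "cmod (of_real (1 - (cmod \<zeta>)\<^sup>2) * deriv (deriv F) \<zeta> - 2 * cnj \<zeta> * deriv F \<zeta>) \<le> 4 * cmod (deriv F \<zeta>)"
proof -
  define \<phi> where "\<phi> = (\<lambda>w. (w + \<zeta>) / (1 + cnj \<zeta> * w))"
  define d where "d = (\<lambda>w. of_real (1 - (cmod \<zeta>)\<^sup>2) / (1 + cnj \<zeta> * w)\<^sup>2)"
  define s where "s = 1 - (cmod \<zeta>)\<^sup>2"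
  have s: "0 < s"
    using \<zeta> by (simp add: s_def power_less_one_iff)
  have M: "\<phi> = Moebius_function 0 (-\<zeta>)"
    by (auto simp: \<phi>_def Moebius_function_def)
  have nz: "1 + cnj \<zeta> * w \<noteq> 0" if "w \<in> ball 0 1" for w
  proof
    assume "1 + cnj \<zeta> * w = 0"
    then have "cnj \<zeta> * w = -1"
      by (simp add: eq_neg_iff_add_eq_0 add.commute)
    then have "cmod \<zeta> * cmod w = 1"
      by (metis complex_mod_cnj norm_minus_cancel norm_mult norm_one)
    moreover have "cmod \<zeta> * cmod w < 1"
      using \<zeta> that mult_strict_mono'[of "cmod \<zeta>" 1 "cmod w" 1] by simp
    ultimately show False by simp
  qed
  have mem: "\<phi> w \<in> ball 0 1" if "w \<in> ball 0 1" for w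
    using that \<zeta> Moebius_function_norm_lt_1[of "-\<zeta>" w 0] by (simp add: M)
  have inj\<phi>: "inj_on \<phi> (ball 0 1)"
  proof (rule inj_on_inverseI)
    show "Moebius_function 0 \<zeta> (\<phi> w) = w" if "w \<in> ball 0 1" for w
      unfolding M using that \<zeta> by (intro Moebius_function_compose) auto
  qed
  have der\<phi>: "(\<phi> has_field_derivative d w) (at w)" if "w \<in> ball 0 1" for w
    unfolding \<phi>_def d_def using nz[OF that]
    by (auto intro!: derivative_eq_intros simp: power2_eq_square complex_norm_square[symmetric] algebra_simps)
  have derd: "(d has_field_derivative - 2 * cnj \<zeta> * of_real s) (at 0)"
    unfolding d_def s_def
    by (auto intro!: derivative_eq_intros)
  define G where "G = F \<circ> \<phi>"
  have hol\<phi>: "\<phi> holomorphic_on ball 0 1"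
    using der\<phi> by (subst holomorphic_on_open) blast+
  have "G holomorphic_on ball 0 1"
    unfolding G_def by (rule holomorphic_on_compose_gen[OF hol\<phi> holF]) (use mem in auto)
  moreover have "inj_on G (ball 0 1)"
    unfolding G_def using mem by (intro comp_inj_on inj\<phi> inj_on_subset[OF inj]) auto
  ultimately have bieb: "cmod (deriv (deriv G) 0) \<le> 4 * cmod (deriv G 0)"
    by (rule bieberbach_second_coefficient)
  have derG: "deriv G w = deriv F (\<phi> w) * d w" if "w \<in> ball 0 1" for w
    unfolding G_def o_def
    by (rule DERIV_imp_deriv, rule DERIV_chain2[OF holomorphic_derivI[OF holF _ mem[OF that]] der\<phi>[OF that]]) auto
  have \<phi>0: "\<phi> 0 = \<zeta>" and d0: "d 0 = of_real s"
    by (simp_all add: \<phi>_def d_def s_def)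
  have "\<forall>\<^sub>F w in nhds 0. deriv G w = deriv F (\<phi> w) * d w"
    using derG by (intro eventually_nhds_in_open[of "ball 0 1", THEN eventually_mono]) auto
  then have "deriv (deriv G) 0 = deriv (\<lambda>w. deriv F (\<phi> w) * d w) 0"
    by (rule deriv_cong_ev) auto
  also have "\<dots> = deriv (deriv F) \<zeta> * of_real s * of_real s + deriv F \<zeta> * (- 2 * cnj \<zeta> * of_real s)"
  proof (rule DERIV_imp_deriv)
    have "(deriv F has_field_derivative deriv (deriv F) \<zeta>) (at (\<phi> 0))"
      unfolding \<phi>0 using \<zeta> by (intro holomorphic_derivI[OF holomorphic_deriv[OF holF]]) auto
    moreover have "(\<phi> has_field_derivative of_real s) (at 0)"
      using der\<phi>[of 0] d0 by simp
    ultimately have "((\<lambda>w. deriv F (\<phi> w)) has_field_derivative deriv (deriv F) \<zeta> * of_real s) (at 0)"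
      by (rule DERIV_chain2)
    from DERIV_mult[OF this derd]
    show "((\<lambda>w. deriv F (\<phi> w) * d w) has_field_derivative
        deriv (deriv F) \<zeta> * of_real s * of_real s + deriv F \<zeta> * (- 2 * cnj \<zeta> * of_real s)) (at 0)"
      by (simp add: \<phi>0 d0 algebra_simps)
  qed
  finally have G2: "deriv (deriv G) 0 = of_real s * (of_real s * deriv (deriv F) \<zeta> - 2 * cnj \<zeta> * deriv F \<zeta>)"
    by (simp add: algebra_simps)
  have "s * cmod (of_real s * deriv (deriv F) \<zeta> - 2 * cnj \<zeta> * deriv F \<zeta>) \<le> s * (4 * cmod (deriv F \<zeta>))"
    using bieb derG[of 0] s unfolding G2 by (simp add: norm_mult \<phi>0 d0 mult_ac)
  then show ?thesis
    using s by (simp add: s_def)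
qed

lemma univalent_second_derivative_ratio:
  assumes holF: "F holomorphic_on ball 0 1" and inj: "inj_on F (ball 0 1)" and z: "cmod z < 1"
  shows "cmod (deriv (deriv F) z) \<le> (4 + 2 * cmod z) / (1 - (cmod z)\<^sup>2) * cmod (deriv F z)"
proof -
  define s where "s = 1 - (cmod z)\<^sup>2"
  have s: "0 < s"
    using z by (simp add: s_def power_less_one_iff)
  have "s * cmod (deriv (deriv F) z) = cmod (of_real s * deriv (deriv F) z)"
    using s by (simp add: norm_mult)
  also have "\<dots> \<le> cmod (of_real s * deriv (deriv F) z - 2 * cnj z * deriv F z) + cmod (2 * cnj z * deriv F z)"
    using norm_triangle_ineq[of "of_real s * deriv (deriv F) z - 2 * cnj z * deriv F z" "2 * cnj z * deriv F z"]
    by simp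
  also have "\<dots> \<le> 4 * cmod (deriv F z) + 2 * cmod z * cmod (deriv F z)"
    using koebe_second_derivative[OF assms] by (simp add: s_def norm_mult)
  finally show ?thesis
    using s by (simp add: s_def field_simps)
qed

text \<open>The bound for \<open>F'' / F'\<close>, which is the derivative of \<open>log F'\<close>, is integrated along the
ray from \<open>0\<close> to \<open>z\<close>.\<close>

theorem koebe_distortion_upper:
  assumes holF: "F holomorphic_on ball 0 1" and inj: "inj_on F (ball 0 1)" and z: "cmod z < 1"
  shows "cmod (deriv F z) \<le> (1 + cmod z) / (1 - cmod z)^3 * cmod (deriv F 0)"
proof -
  define r where "r = cmod z"
  have r: "0 \<le> r" "r < 1"
    using z by (auto simp: r_def)
  have holF': "deriv F holomorphic_on ball 0 1"
    using holF by (intro holomorphic_deriv) auto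
  have nz: "deriv F w \<noteq> 0" if "w \<in> ball 0 1" for w
    by (rule holomorphic_injective_imp_regular[OF holF _ inj that]) auto
  have "contractible (ball (0::complex) 1)"
    by (intro convex_imp_contractible) auto
  then obtain l where holl: "l holomorphic_on ball 0 1"
    and l: "\<And>w. w \<in> ball 0 1 \<Longrightarrow> deriv F w = exp (l w)"
    using contractible_imp_holomorphic_log[OF holF' _ nz] by metis
  have derl: "deriv l w = deriv (deriv F) w / deriv F w" if "w \<in> ball 0 1" for w
  proof -
    have "\<forall>\<^sub>F u in nhds w. deriv F u = exp (l u)"
      using l that by (intro eventually_nhds_in_open[of "ball 0 1", THEN eventually_mono]) auto
    then have "deriv (deriv F) w = deriv (\<lambda>u. exp (l u)) w"
      by (rule deriv_cong_ev) auto
    also have "\<dots> = deriv F w * deriv l w"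
      using that by (intro DERIV_imp_deriv)
        (auto intro!: derivative_eq_intros holomorphic_derivI[OF holl] simp: l)
    finally show ?thesis
      using nz[OF that] by simp
  qed
  have tz: "of_real t * z \<in> ball 0 1" "t * r < 1" if "0 \<le> t" "t \<le> 1" for t :: real
    using that r mult_left_le_one_le[of r t] by (auto simp: norm_mult r_def)
  define \<psi> where "\<psi> = (\<lambda>t. ln (1 + t * r) - 3 * ln (1 - t * r))"
  have "norm (l (of_real 1 * z) - l (of_real 0 * z)) \<le> \<psi> 1 - \<psi> 0"
  proof (rule differentiable_bound_general)
    have derlt: "((\<lambda>t. l (of_real t * z)) has_vector_derivative z * deriv l (of_real t * z)) (at t within S)"
      if "0 \<le> t" "t \<le> 1" for t S
    proof -
      have "(l has_field_derivative deriv l (of_real t * z)) (at (of_real t * z))"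
        by (intro holomorphic_derivI[OF holl _ tz(1)[OF that]]) auto
      moreover have "((\<lambda>t. of_real t * z) has_vector_derivative z) (at t within S)"
        by (auto intro!: derivative_eq_intros)
      ultimately show ?thesis
        using field_vector_diff_chain_within[of "\<lambda>t. of_real t * z" z t S l "deriv l (of_real t * z)"]
        by (auto simp: o_def intro: has_field_derivative_at_within)
    qed
    show "continuous_on {0..1} (\<lambda>t. l (of_real t * z))"
      by (rule continuous_on_vector_derivative[OF derlt]) auto
    show "((\<lambda>t. l (of_real t * z)) has_vector_derivative z * deriv l (of_real t * z)) (at t)"
      if "0 < t" "t < 1" for t
      using derlt[of t UNIV] that by simp
    show "continuous_on {0..1} \<psi>"
      unfolding \<psi>_def using tz(2) r by (intro continuous_intros) (auto simp: add_nonneg_eq_0_iff, force+)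
    show "(\<psi> has_vector_derivative r * ((4 + 2 * (t * r)) / (1 - (t * r)\<^sup>2))) (at t)"
      if "0 < t" "t < 1" for t
    proof -
      have *: "0 < 1 + t * r" "0 < 1 - t * r"
        using tz(2)[of t] that r by (auto intro: add_pos_nonneg)
      then have "(\<psi> has_real_derivative r / (1 + t * r) - 3 * (- r / (1 - t * r))) (at t)"
        unfolding \<psi>_def by (auto intro!: derivative_eq_intros simp: divide_inverse mult_ac)
      moreover have "r / (1 + t * r) - 3 * (- r / (1 - t * r)) = r * ((4 + 2 * (t * r)) / ((1 + t * r) * (1 - t * r)))"
        using * by (simp add: field_simps)
      moreover have "(1 + t * r) * (1 - t * r) = 1 - (t * r)\<^sup>2"
        by (simp add: power2_eq_square algebra_simps)
      ultimately show ?thesis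
        by (simp flip: has_real_derivative_iff_has_vector_derivative)
    qed
    show "norm (z * deriv l (of_real t * z)) \<le> r * ((4 + 2 * (t * r)) / (1 - (t * r)\<^sup>2))"
      if "0 < t" "t < 1" for t
    proof -
      have b: "of_real t * z \<in> ball 0 1" and n: "cmod (of_real t * z) = t * r"
        using tz(1)[of t] that by (auto simp: norm_mult r_def)
      have "cmod (deriv (deriv F) (of_real t * z)) \<le> (4 + 2 * (t * r)) / (1 - (t * r)\<^sup>2) * cmod (deriv F (of_real t * z))"
        using univalent_second_derivative_ratio[OF holF inj, of "of_real t * z"] tz(2)[of t] that unfolding n by simp
      then have "cmod (deriv l (of_real t * z)) \<le> (4 + 2 * (t * r)) / (1 - (t * r)\<^sup>2)"
        using nz[OF b] by (simp add: derl[OF b] norm_divide pos_divide_le_eq)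
      then show ?thesis
        unfolding norm_mult r_def[symmetric] using r by (intro mult_left_mono)
    qed
  qed auto
  then have "cmod (l z - l 0) \<le> ln (1 + r) - 3 * ln (1 - r)"
    by (simp add: \<psi>_def)
  then have "Re (l z - l 0) \<le> ln (1 + r) - 3 * ln (1 - r)"
    using complex_Re_le_cmod order_trans by blast
  then have "exp (Re (l z - l 0)) \<le> exp (ln (1 + r) - 3 * ln (1 - r))"
    by simp
  also have "\<dots> = (1 + r) / (1 - r)^3"
  proof -
    have "exp (3 * ln (1 - r)) = (1 - r)^3"
      using r exp_of_nat_mult[of 3 "ln (1 - r)"] by simp
    then show ?thesis
      using r by (simp add: exp_diff)
  qed
  finally have "exp (Re (l z - l 0)) \<le> (1 + r) / (1 - r)^3" .
  then have "exp (Re (l z - l 0)) * cmod (deriv F 0) \<le> (1 + r) / (1 - r)^3 * cmod (deriv F 0)"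
    by (rule mult_right_mono) simp
  moreover have "deriv F z = exp (l z - l 0) * deriv F 0"
    using z l by (simp add: exp_diff)
  then have "cmod (deriv F z) = exp (Re (l z - l 0)) * cmod (deriv F 0)"
    by (simp only: norm_mult norm_exp_eq_Re)
  ultimately show ?thesis
    unfolding r_def by simp
qed

section \<open>Harmonic maps onto convex domains\<close>

lemma harmonic_has_derivative:
  assumes "h holomorphic_on S" "g holomorphic_on S" "open S" "z \<in> S"
    and "\<And>w. w \<in> S \<Longrightarrow> f w = h w + cnj (g w)"
  shows "(f has_derivative (\<lambda>u. deriv h z * u + cnj (deriv g z * u))) (at z)"
proof -
  have "(h has_derivative (*) (deriv h z)) (at z)" "(g has_derivative (*) (deriv g z)) (at z)"
    using assms holomorphic_derivI by (blast intro: has_field_derivative_imp_has_derivative)+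
  then have "((\<lambda>w. h w + cnj (g w)) has_derivative (\<lambda>u. deriv h z * u + cnj (deriv g z * u))) (at z)"
    by (intro has_derivative_add has_derivative_cnj)
  then show ?thesis
    by (rule has_derivative_transform_within_open[OF _ assms(3,4)]) (use assms(5) in auto)
qed

text \<open>The derivative \<open>u \<mapsto> h' u + cnj (g' u)\<close> has determinant \<open>|h'|\<^sup>2 - |g'|\<^sup>2 > 0\<close>, and the
formula is its inverse.\<close>

lemma harmonic_inverse_has_derivative:
  assumes hol: "h holomorphic_on S" "g holomorphic_on S" and S: "open S"
    and f: "\<And>w. w \<in> S \<Longrightarrow> f w = h w + cnj (g w)"
    and inj: "inj_on f S" and z: "z \<in> S" and lt: "cmod (deriv g z) < cmod (deriv h z)"
  shows "(the_inv_into S f has_derivative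
     (\<lambda>W. (cnj (deriv h z) * W - cnj (deriv g z) * cnj W) /
          of_real ((cmod (deriv h z))\<^sup>2 - (cmod (deriv g z))\<^sup>2))) (at (f z))"
proof (rule has_derivative_inverse_strong[OF S z])
  have "(f has_derivative (\<lambda>u. deriv h w * u + cnj (deriv g w * u))) (at w)" if "w \<in> S" for w
    using that hol S f by (intro harmonic_has_derivative)
  then show "continuous_on S f"
    by (meson S continuous_on_eq_continuous_at has_derivative_continuous)
  show "(f has_derivative (\<lambda>u. deriv h z * u + cnj (deriv g z * u))) (at z)"
    using z hol S f by (intro harmonic_has_derivative)
  show "the_inv_into S f (f x) = x" if "x \<in> S" for x
    using inj that by (rule the_inv_into_f_f)
  define J where "J = complex_of_real ((cmod (deriv h z))\<^sup>2 - (cmod (deriv g z))\<^sup>2)"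
  have "(cmod (deriv g z))\<^sup>2 < (cmod (deriv h z))\<^sup>2"
    using lt by (intro power_strict_mono) auto
  then have J0: "J \<noteq> 0" and Jc: "cnj J = J"
    by (auto simp: J_def simp del: of_real_diff of_real_power)
  have Jeq: "J = deriv h z * cnj (deriv h z) - deriv g z * cnj (deriv g z)"
    by (simp only: J_def of_real_diff complex_norm_square)
  show "(\<lambda>u. deriv h z * u + cnj (deriv g z * u)) \<circ>
      (\<lambda>W. (cnj (deriv h z) * W - cnj (deriv g z) * cnj W) /
        of_real ((cmod (deriv h z))\<^sup>2 - (cmod (deriv g z))\<^sup>2)) = id"
  proof
    fix W
    have "deriv h z * ((cnj (deriv h z) * W - cnj (deriv g z) * cnj W) / J)
        + cnj (deriv g z * ((cnj (deriv h z) * W - cnj (deriv g z) * cnj W) / J))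
        = (deriv h z * (cnj (deriv h z) * W - cnj (deriv g z) * cnj W)
          + cnj (deriv g z) * (deriv h z * cnj W - deriv g z * W)) / J"
      by (simp add: Jc add_divide_distrib)
    also have "\<dots> = (J * W) / J"
      by (simp add: Jeq algebra_simps)
    finally show "((\<lambda>u. deriv h z * u + cnj (deriv g z * u)) \<circ>
      (\<lambda>W. (cnj (deriv h z) * W - cnj (deriv g z) * cnj W) /
        of_real ((cmod (deriv h z))\<^sup>2 - (cmod (deriv g z))\<^sup>2))) W = id W"
      unfolding o_def J_def[symmetric] using J0 by simp
  qed
qed

text \<open>The velocity \<open>u\<close> of the preimage of a line traversed with velocity \<open>W\<close>. Convexity of the image
enters the later arguments through such preimages of segments.\<close>

lemma segment_preimage_derivative:
  assumes hol: "h holomorphic_on S" "g holomorphic_on S" and S: "open S"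
    and f: "\<And>w. w \<in> S \<Longrightarrow> f w = h w + cnj (g w)"
    and inj: "inj_on f S" and lt: "\<And>z. z \<in> S \<Longrightarrow> cmod (deriv g z) < cmod (deriv h z)"
    and mem: "w + of_real s * W \<in> f ` S"
  obtains u where "((\<lambda>s. the_inv_into S f (w + of_real s * W)) has_vector_derivative u) (at s)"
    and "deriv h (the_inv_into S f (w + of_real s * W)) * u
         + cnj (deriv g (the_inv_into S f (w + of_real s * W)) * u) = W"
proof -
  define F where "F = the_inv_into S f"
  obtain z where z: "z \<in> S" "f z = w + of_real s * W"
    using mem by auto
  have Fz: "F (w + of_real s * W) = z"
    using z the_inv_into_f_f[OF inj z(1)] by (simp add: F_def)
  define L where "L = (\<lambda>W. (cnj (deriv h z) * W - cnj (deriv g z) * cnj W) /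
          of_real ((cmod (deriv h z))\<^sup>2 - (cmod (deriv g z))\<^sup>2))"
  have L: "(F has_derivative L) (at (f z))"
    unfolding F_def L_def by (rule harmonic_inverse_has_derivative[OF hol S f inj z(1) lt[OF z(1)]])
  have lin: "((\<lambda>s. w + of_real s * W) has_derivative (\<lambda>t. of_real t * W)) (at s)"
    by (auto intro!: derivative_eq_intros)
  have "((\<lambda>s. F (w + of_real s * W)) has_derivative (\<lambda>t. L (of_real t * W))) (at s)"
    using has_derivative_compose[OF lin, of F L] L z(2) by simp
  moreover have "L (of_real t * W) = t *\<^sub>R L W" for t
    using linear_scale[OF has_derivative_linear[OF L], of t W] by (simp add: scaleR_conv_of_real)
  ultimately have vd: "((\<lambda>s. F (w + of_real s * W)) has_vector_derivative L W) (at s)"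
    by (simp add: has_vector_derivative_def)
  have df: "(f has_derivative (\<lambda>u. deriv h z * u + cnj (deriv g z * u))) (at z)"
    by (rule harmonic_has_derivative[OF hol S z(1) f])
  have comp: "((\<lambda>v. f (F v)) has_derivative (\<lambda>v. deriv h z * L v + cnj (deriv g z * L v))) (at (f z))"
    using has_derivative_compose[OF L, of f] df Fz z(2) by simp
  have "open (f ` S)"
  proof (rule invariance_of_domain[OF _ S inj])
    show "continuous_on S f"
      by (meson S continuous_on_eq_continuous_at has_derivative_continuous harmonic_has_derivative[OF hol S _ f])
  qed
  have "((\<lambda>v. v) has_derivative (\<lambda>v. deriv h z * L v + cnj (deriv g z * L v))) (at (f z))"
    by (rule has_derivative_transform_within_open[OF comp \<open>open (f ` S)\<close>])
       (use z(1) in \<open>auto simp: F_def the_inv_into_f_f[OF inj]\<close>)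
  then have "(\<lambda>v. deriv h z * L v + cnj (deriv g z * L v)) = (\<lambda>v. v)"
    using has_derivative_ident has_derivative_unique by blast
  then have "deriv h z * L W + cnj (deriv g z * L W) = W"
    by meson
  with vd show ?thesis
    using that[of "L W"] Fz by (simp add: F_def)
qed

lemma cmod_diff_squared: "(cmod (a - b))\<^sup>2 = (cmod a)\<^sup>2 - 2 * Re (cnj a * b) + (cmod b)\<^sup>2"
  unfolding cmod_power2 by (simp add: power2_eq_square algebra_simps)

text \<open>Pull the segment from \<open>f z1\<close> to \<open>f z2\<close> back by \<open>f\<close>. Along the preimage, \<open>X = h' u\<close> and
\<open>Y = g' u\<close> satisfy \<open>X + cnj Y = W\<close> and \<open>|Y| < |X|\<close>, which together mean
\<open>2 Re (cnj W X) > |W|\<^sup>2\<close>. This inequality is linear in \<open>X\<close>, so it survives integration, and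
it then says the same about the differences of \<open>h\<close> and \<open>g\<close>. In particular all the functions
\<open>h + \<epsilon> g\<close> with \<open>|\<epsilon>| = 1\<close> are injective.\<close>

lemma convex_harmonic_difference_bound:
  assumes hol: "h holomorphic_on S" "g holomorphic_on S" and S: "open S"
    and f: "\<And>w. w \<in> S \<Longrightarrow> f w = h w + cnj (g w)"
    and inj: "inj_on f S" and lt: "\<And>z. z \<in> S \<Longrightarrow> cmod (deriv g z) < cmod (deriv h z)"
    and conv: "convex (f ` S)" and z: "z1 \<in> S" "z2 \<in> S" "z1 \<noteq> z2"
  shows "cmod (g z2 - g z1) < cmod (h z2 - h z1)"
proof -
  define W where "W = f z2 - f z1"
  define \<gamma> where "\<gamma> = (\<lambda>s. the_inv_into S f (f z1 + of_real s * W))"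
  define P where "P = (\<lambda>s. 2 * Re (cnj W * h (\<gamma> s)) - s * (cmod W)\<^sup>2)"
  have W0: "W \<noteq> 0"
    using inj z unfolding W_def inj_on_def by auto
  have mem: "f z1 + of_real s * W \<in> f ` S" if "0 \<le> s" "s \<le> 1" for s
  proof -
    have "f z1 + of_real s * W = (1 - s) *\<^sub>R f z1 + s *\<^sub>R f z2"
      by (simp add: W_def algebra_simps scaleR_conv_of_real)
    then show ?thesis
      using convexD[OF conv, of "f z1" "f z2" "1 - s" s] z that by simp
  qed
  have "P 0 < P 1"
  proof (rule DERIV_pos_imp_increasing[where f = P])
    fix s :: real assume s: "0 \<le> s" "s \<le> 1"
    obtain u where u: "(\<gamma> has_vector_derivative u) (at s)"
      and eq: "deriv h (\<gamma> s) * u + cnj (deriv g (\<gamma> s) * u) = W"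
      unfolding \<gamma>_def by (rule segment_preimage_derivative[OF hol S f inj lt mem[OF s]])
    have \<gamma>S: "\<gamma> s \<in> S"
      unfolding \<gamma>_def using mem[OF s] the_inv_into_into[OF inj _ order_refl] by blast
    have "(h has_field_derivative deriv h (\<gamma> s)) (at (\<gamma> s))"
      by (rule holomorphic_derivI[OF hol(1) S \<gamma>S])
    then have "((\<lambda>s. h (\<gamma> s)) has_vector_derivative u * deriv h (\<gamma> s)) (at s)"
      using field_vector_diff_chain_at[OF u] by (simp add: o_def)
    then have "((\<lambda>s. cnj W * h (\<gamma> s)) has_vector_derivative cnj W * (u * deriv h (\<gamma> s))) (at s)"
      by (rule has_vector_derivative_mult_right)
    then have "((\<lambda>s. Re (cnj W * h (\<gamma> s))) has_vector_derivative Re (cnj W * (u * deriv h (\<gamma> s)))) (at s)"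
      by (rule bounded_linear.has_vector_derivative[OF bounded_linear_Re])
    then have "((\<lambda>s. Re (cnj W * h (\<gamma> s))) has_real_derivative Re (cnj W * (u * deriv h (\<gamma> s)))) (at s)"
      by (simp add: has_real_derivative_iff_has_vector_derivative)
    from DERIV_diff[OF DERIV_cmult[OF this, of 2] DERIV_cmult_right[OF DERIV_ident]]
    have "(P has_real_derivative 2 * Re (cnj W * (u * deriv h (\<gamma> s))) - (cmod W)\<^sup>2) (at s)"
      unfolding P_def mult_1 .
    moreover have "0 < 2 * Re (cnj W * (u * deriv h (\<gamma> s))) - (cmod W)\<^sup>2"
    proof -
      define X where "X = deriv h (\<gamma> s) * u"
      have "u \<noteq> 0"
        using eq W0 by auto
      then have "cmod (deriv g (\<gamma> s) * u) < cmod X"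
        using lt[OF \<gamma>S] by (simp add: X_def norm_mult)
      moreover have "W - X = cnj (deriv g (\<gamma> s) * u)"
        using eq by (simp add: X_def algebra_simps)
      ultimately have "cmod (W - X) < cmod X"
        by (metis complex_mod_cnj)
      then have "(cmod (W - X))\<^sup>2 < (cmod X)\<^sup>2"
        by (intro power_strict_mono) auto
      then have "(cmod W)\<^sup>2 < 2 * Re (cnj W * X)"
        unfolding cmod_diff_squared by linarith
      then show ?thesis
        by (simp only: X_def mult.commute[of u] diff_gt_0_iff_gt)
    qed
    ultimately show "\<exists>y. (P has_real_derivative y) (at s) \<and> 0 < y"
      by blast
  qed simp
  moreover have "\<gamma> 0 = z1" "\<gamma> 1 = z2"
    using z by (simp_all add: \<gamma>_def W_def the_inv_into_f_f[OF inj])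
  ultimately have "(cmod W)\<^sup>2 < 2 * Re (cnj W * (h z2 - h z1))"
    by (simp add: P_def algebra_simps)
  then have "(cmod (W - (h z2 - h z1)))\<^sup>2 < (cmod (h z2 - h z1))\<^sup>2"
    unfolding cmod_diff_squared by linarith
  moreover have "W - (h z2 - h z1) = cnj (g z2 - g z1)"
    using z f by (simp add: W_def)
  ultimately have "(cmod (g z2 - g z1))\<^sup>2 < (cmod (h z2 - h z1))\<^sup>2"
    by (metis complex_mod_cnj)
  then show ?thesis
    by (rule power2_less_imp_less) simp
qed

lemma rotation_aligning_norms:
  obtains \<epsilon> :: complex where "cmod \<epsilon> = 1" "cmod (a + \<epsilon> * b) = cmod a + cmod b"
proof (cases "a = 0 \<or> b = 0")
  case True
  then show ?thesis
    by (intro that[of 1]) auto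
next
  case False
  define \<epsilon> where "\<epsilon> = sgn a / sgn b"
  have "\<epsilon> * b = of_real (cmod b) * sgn a"
    using False by (simp add: \<epsilon>_def sgn_eq field_simps)
  moreover have "a = of_real (cmod a) * sgn a"
    using False by (simp add: sgn_eq)
  ultimately have "a + \<epsilon> * b = of_real (cmod a + cmod b) * sgn a"
    by (metis distrib_right of_real_add)
  then have "cmod (a + \<epsilon> * b) = cmod a + cmod b"
    using False by (simp only: norm_mult norm_of_real norm_sgn) simp
  then show ?thesis
    using False by (intro that[of \<epsilon>]) (auto simp: \<epsilon>_def norm_divide norm_sgn)
qed

text \<open>The distortion bounds of \<open>h + \<epsilon> g\<close>, with \<open>\<epsilon>\<close> chosen at the given point so that the moduli
of the two summands add up.\<close>

lemma pair_distortion: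
  assumes hol: "h holomorphic_on ball 0 1" "g holomorphic_on ball 0 1"
    and inj: "\<And>\<epsilon>. cmod \<epsilon> = 1 \<Longrightarrow> inj_on (\<lambda>z. h z + \<epsilon> * g z) (ball 0 1)"
    and norm: "deriv h 0 = 1" "deriv g 0 = 0" and z: "cmod z < 1"
  shows "cmod (deriv h z) + cmod (deriv g z) \<le> (1 + cmod z) / (1 - cmod z)^3"
    and "cmod (deriv (deriv h) z) + cmod (deriv (deriv g) z) \<le> (4 + 2 * cmod z) / (1 - cmod z)^4"
proof -
  define r where "r = cmod z"
  have r: "0 \<le> r" "r < 1"
    using z by (auto simp: r_def)
  define F where "F = (\<lambda>\<epsilon> z. h z + \<epsilon> * g z)"
  have holF: "F \<epsilon> holomorphic_on ball 0 1" for \<epsilon>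
    unfolding F_def by (intro holomorphic_intros hol)
  have injF: "inj_on (F \<epsilon>) (ball 0 1)" if "cmod \<epsilon> = 1" for \<epsilon>
    unfolding F_def by (rule inj[OF that])
  have d1: "deriv (F \<epsilon>) w = deriv h w + \<epsilon> * deriv g w" if "w \<in> ball 0 1" for \<epsilon> w
    unfolding F_def
    by (rule DERIV_imp_deriv) (use that in \<open>auto intro!: derivative_eq_intros holomorphic_derivI[OF hol(1)] holomorphic_derivI[OF hol(2)]\<close>)
  have d2: "deriv (deriv (F \<epsilon>)) z = deriv (deriv h) z + \<epsilon> * deriv (deriv g) z" for \<epsilon>
  proof -
    have "\<forall>\<^sub>F w in nhds z. deriv (F \<epsilon>) w = deriv h w + \<epsilon> * deriv g w"
      using d1 z by (intro eventually_nhds_in_open[of "ball 0 1", THEN eventually_mono]) auto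
    then have "deriv (deriv (F \<epsilon>)) z = deriv (\<lambda>w. deriv h w + \<epsilon> * deriv g w) z"
      by (rule deriv_cong_ev) auto
    also have "\<dots> = deriv (deriv h) z + \<epsilon> * deriv (deriv g) z"
      using z by (intro DERIV_imp_deriv)
         (auto intro!: derivative_eq_intros holomorphic_derivI[OF holomorphic_deriv[OF hol(1)]]
           holomorphic_derivI[OF holomorphic_deriv[OF hol(2)]])
    finally show ?thesis .
  qed
  have B1: "cmod (deriv (F \<epsilon>) z) \<le> (1 + r) / (1 - r)^3" if "cmod \<epsilon> = 1" for \<epsilon>
    using koebe_distortion_upper[OF holF injF[OF that] z] d1[of 0 \<epsilon>] norm by (simp add: r_def)
  have B2: "cmod (deriv (deriv (F \<epsilon>)) z) \<le> (4 + 2 * r) / (1 - r)^4" if "cmod \<epsilon> = 1" for \<epsilon>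
  proof -
    have s: "0 < 1 - r\<^sup>2"
      using r by (simp add: power_less_one_iff)
    have "cmod (deriv (deriv (F \<epsilon>)) z) \<le> (4 + 2 * r) / (1 - r\<^sup>2) * cmod (deriv (F \<epsilon>) z)"
      unfolding r_def by (rule univalent_second_derivative_ratio[OF holF injF[OF that] z])
    also have "\<dots> \<le> (4 + 2 * r) / (1 - r\<^sup>2) * ((1 + r) / (1 - r)^3)"
      using r s by (intro mult_left_mono B1[OF that]) auto
    also have "\<dots> = (4 + 2 * r) / (1 - r)^4"
    proof -
      have "1 - r\<^sup>2 = (1 + r) * (1 - r)"
        by (simp add: power2_eq_square algebra_simps)
      then show ?thesis
        using r by (simp add: power_numeral_reduce)
    qed
    finally show ?thesis .
  qed
  obtain \<epsilon> where "cmod \<epsilon> = 1" "cmod (deriv h z + \<epsilon> * deriv g z) = cmod (deriv h z) + cmod (deriv g z)"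
    by (rule rotation_aligning_norms)
  then show "cmod (deriv h z) + cmod (deriv g z) \<le> (1 + cmod z) / (1 - cmod z)^3"
    using B1[of \<epsilon>] d1[of z \<epsilon>] z by (simp add: r_def)
  obtain \<epsilon> where "cmod \<epsilon> = 1"
    "cmod (deriv (deriv h) z + \<epsilon> * deriv (deriv g) z) = cmod (deriv (deriv h) z) + cmod (deriv (deriv g) z)"
    by (rule rotation_aligning_norms)
  then show "cmod (deriv (deriv h) z) + cmod (deriv (deriv g) z) \<le> (4 + 2 * cmod z) / (1 - cmod z)^4"
    using B2[of \<epsilon>] d2[of \<epsilon>] by (simp add: r_def)
qed

text \<open>The dilatation \<open>\<omega> = g' / h'\<close> maps the disk into itself and vanishes at \<open>0\<close>, so
\<open>|g'| \<le> |z| |h'|\<close> by the Schwarz lemma. With the bound for \<open>|h'| + |g'|\<close> this gives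
\<open>|g'| \<le> r / (1 - r)\<^sup>3\<close>, which is integrated along the ray.\<close>

lemma coanalytic_part_growth:
  assumes hol: "h holomorphic_on ball 0 1" "g holomorphic_on ball 0 1"
    and lt: "\<And>z. z \<in> ball 0 1 \<Longrightarrow> cmod (deriv g z) < cmod (deriv h z)"
    and g0: "g 0 = 0" "deriv g 0 = 0"
    and sum: "\<And>z. z \<in> ball 0 1 \<Longrightarrow> cmod (deriv h z) + cmod (deriv g z) \<le> (1 + cmod z) / (1 - cmod z)^3"
    and z: "cmod z < 1"
  shows "cmod (g z) \<le> (cmod z)\<^sup>2 / (2 * (1 - cmod z)\<^sup>2)"
proof -
  define r where "r = cmod z"
  have r: "0 \<le> r" "r < 1"
    using z by (auto simp: r_def)
  define \<omega> where "\<omega> = (\<lambda>z. deriv g z / deriv h z)"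
  have "\<omega> holomorphic_on ball 0 1"
    unfolding \<omega>_def using lt by (intro holomorphic_intros holomorphic_deriv hol) force+
  moreover have "cmod (\<omega> w) < 1" if "cmod w < 1" for w
    using lt[of w] that by (simp add: \<omega>_def norm_divide divide_less_eq)
  ultimately have sch: "cmod (\<omega> w) \<le> cmod w" if "cmod w < 1" for w
    using Schwarz_Lemma(1)[of \<omega> w] that by (simp add: \<omega>_def g0)
  have g': "cmod (deriv g w) \<le> cmod w / (1 - cmod w)^3" if w: "cmod w < 1" for w
  proof -
    have "deriv h w \<noteq> 0"
      using lt[of w] w by auto
    then have "cmod (deriv g w) \<le> cmod w * cmod (deriv h w)"
      using sch[OF w] by (simp add: \<omega>_def norm_divide divide_le_eq)
    then have "(1 + cmod w) * cmod (deriv g w) \<le> cmod w * (cmod (deriv h w) + cmod (deriv g w))"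
      by (simp add: algebra_simps)
    also have "\<dots> \<le> cmod w * ((1 + cmod w) / (1 - cmod w)^3)"
      using sum[of w] w by (intro mult_left_mono) auto
    also have "\<dots> = (1 + cmod w) * (cmod w / (1 - cmod w)^3)"
      by simp
    finally show ?thesis
      by (rule mult_left_le_imp_le) (simp add: add_pos_nonneg)
  qed
  have tz: "of_real t * z \<in> ball 0 1" "t * r < 1" if "0 \<le> t" "t \<le> 1" for t :: real
    using that r mult_left_le_one_le[of r t] by (auto simp: norm_mult r_def)
  define \<psi> where "\<psi> = (\<lambda>t. (t * r)\<^sup>2 / (2 * (1 - t * r)\<^sup>2))"
  have "norm (g (of_real 1 * z) - g (of_real 0 * z)) \<le> \<psi> 1 - \<psi> 0"
  proof (rule differentiable_bound_general)
    have der: "((\<lambda>t. g (of_real t * z)) has_vector_derivative z * deriv g (of_real t * z)) (at t within S)"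
      if "0 \<le> t" "t \<le> 1" for t S
    proof -
      have "(g has_field_derivative deriv g (of_real t * z)) (at (of_real t * z))"
        by (intro holomorphic_derivI[OF hol(2) _ tz(1)[OF that]]) auto
      moreover have "((\<lambda>t. of_real t * z) has_vector_derivative z) (at t within S)"
        by (auto intro!: derivative_eq_intros)
      ultimately show ?thesis
        using field_vector_diff_chain_within[of "\<lambda>t. of_real t * z" z t S g "deriv g (of_real t * z)"]
        by (auto simp: o_def intro: has_field_derivative_at_within)
    qed
    show "continuous_on {0..1} (\<lambda>t. g (of_real t * z))"
      by (rule continuous_on_vector_derivative[OF der]) auto
    show "((\<lambda>t. g (of_real t * z)) has_vector_derivative z * deriv g (of_real t * z)) (at t)"
      if "0 < t" "t < 1" for t
      using der[of t UNIV] that by simp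
    show "continuous_on {0..1} \<psi>"
      unfolding \<psi>_def using tz(2) by (intro continuous_intros) force
    show "(\<psi> has_vector_derivative r * (t * r / (1 - t * r)^3)) (at t)"
      if "0 < t" "t < 1" for t
    proof -
      define s where "s = 1 - t * r"
      have s: "s \<noteq> 0" "t * r = 1 - s"
        using tz(2)[of t] that by (auto simp: s_def)
      have "(\<psi> has_real_derivative (2 * (t * r) * r * (2 * s\<^sup>2) - (t * r)\<^sup>2 * (2 * (2 * s * (- r)))) / (2 * s\<^sup>2)\<^sup>2) (at t)"
        unfolding \<psi>_def s_def using s(1)[unfolded s_def]
        by (auto intro!: derivative_eq_intros simp: power2_eq_square)
      moreover have "(2 * (t * r) * r * (2 * s\<^sup>2) - (t * r)\<^sup>2 * (2 * (2 * s * (- r)))) / (2 * s\<^sup>2)\<^sup>2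
          = r * (t * r / s^3)"
        using s(1) unfolding s(2) by (simp add: field_simps power2_eq_square power3_eq_cube)
      ultimately show ?thesis
        by (simp add: s_def flip: has_real_derivative_iff_has_vector_derivative)
    qed
    show "norm (z * deriv g (of_real t * z)) \<le> r * (t * r / (1 - t * r)^3)"
      if "0 < t" "t < 1" for t
      unfolding norm_mult r_def[symmetric]
      using g'[of "of_real t * z"] tz[of t] that r
      by (intro mult_left_mono) (auto simp: norm_mult r_def)
  qed auto
  then show ?thesis
    by (simp add: \<psi>_def g0 r_def)
qed

section \<open>The derivative of the argument\<close>

text \<open>Write \<open>A = z h' - cnj (z g')\<close>, \<open>B = h + cnj g\<close>, \<open>\<beta> = 1 - \<alpha>\<close>. If \<open>Re (A / B) \<le> \<alpha>\<close>,
then \<open>v = 1 - A / B\<close> satisfies \<open>Re v \<ge> \<beta>\<close> and \<open>A - (1 - v) B = 0\<close>. Taylor's formula along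
the ray from \<open>0\<close> to \<open>z\<close> turns the last equation, divided by \<open>z\<close>, into
\<open>0 = v + \<integral> ((t + (1 - t) v) x(t) - (t + (1 - t) m) y(t)) dt - 2 (1 - \<beta>) cnj (g z) / z\<close>
with the integral over \<open>[0, 1]\<close>,
where \<open>x(t) = z h''(t z)\<close>, \<open>y(t) = cnj (z\<^sup>2 g''(t z)) / z\<close> and \<open>m = 2 \<beta> - v\<close>. The constant
\<open>2 (1 - \<beta>)\<close> in front of \<open>g\<close> is chosen so that \<open>m\<close> is the reflection of \<open>v\<close> in the
point \<open>\<beta>\<close>; as \<open>Re v \<ge> \<beta>\<close>, this gives \<open>|m| \<le> |v|\<close>. Since \<open>|v| \<ge> \<beta>\<close>, both weights are at most
\<open>(|v| / \<beta>) (t + \<beta> (1 - t))\<close>. Hence the same factor \<open>|v| / \<beta>\<close> comes out of every estimate, and the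
case \<open>v = \<beta>\<close> decides whether the remaining terms can cancel \<open>v\<close>: they cannot if
\<open>(1 + r) / (1 - r)\<^sup>3 < 2 - \<alpha> + \<alpha> r / (1 - r)\<close>.\<close>

lemma argument_derivative_lower_bound:
  assumes hol: "h holomorphic_on ball 0 1" "g holomorphic_on ball 0 1"
    and norm: "h 0 = 0" "deriv h 0 = 1" "g 0 = 0" "deriv g 0 = 0"
    and second: "\<And>w. w \<in> ball 0 1 \<Longrightarrow> cmod (deriv (deriv h) w) + cmod (deriv (deriv g) w)
                   \<le> (4 + 2 * cmod w) / (1 - cmod w)^4"
    and gz: "cmod (g z) \<le> (cmod z)\<^sup>2 / (2 * (1 - cmod z)\<^sup>2)"
    and \<alpha>: "0 \<le> \<alpha>" "\<alpha> < 1" and z: "z \<noteq> 0" "cmod z < 1"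
    and K: "(1 + cmod z) / (1 - cmod z)^3 < (2 - \<alpha>) + \<alpha> * cmod z / (1 - cmod z)"
    and nz: "h z + cnj (g z) \<noteq> 0"
  shows "\<alpha> < Re ((z * deriv h z - cnj (z * deriv g z)) / (h z + cnj (g z)))"
proof (rule ccontr)
  define A where "A = z * deriv h z - cnj (z * deriv g z)"
  define B where "B = h z + cnj (g z)"
  assume "\<not> ?thesis"
  then have neg: "Re (A / B) \<le> \<alpha>"
    by (simp add: A_def B_def)
  define r where "r = cmod z"
  define \<beta> where "\<beta> = 1 - \<alpha>"
  define v where "v = 1 - A / B"
  define m where "m = 2 * of_real \<beta> - v"
  have r: "0 < r" "r < 1"
    using z by (auto simp: r_def)
  have \<beta>: "0 < \<beta>" "\<beta> \<le> 1"
    using \<alpha> by (auto simp: \<beta>_def)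
  have Rev: "\<beta> \<le> Re v"
    using neg by (simp add: v_def \<beta>_def)
  have v\<beta>: "\<beta> \<le> cmod v"
    using Rev complex_Re_le_cmod[of v] by linarith
  have mv: "cmod m \<le> cmod v"
  proof -
    have "(cmod m)\<^sup>2 = (cmod v)\<^sup>2 - 4 * \<beta> * (Re v - \<beta>)"
      unfolding m_def cmod_power2 by (simp add: power2_eq_square algebra_simps)
    also have "\<dots> \<le> (cmod v)\<^sup>2"
      using Rev \<beta> by simp
    finally show ?thesis
      by (rule power2_le_imp_le) simp
  qed
  have tr: "t * r < 1" if "0 \<le> t" "t \<le> 1" for t :: real
    using that r mult_left_le_one_le[of r t] by linarith
  then have tz: "of_real t * z \<in> ball 0 1" "t * r < 1" if "0 \<le> t" "t \<le> 1" for t :: real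
    using that by (simp_all add: norm_mult r_def)
  \<comment> \<open>an antiderivative in \<open>t\<close> of the integrand \<open>\<Phi>'\<close>\<close>
  define \<Phi> where "\<Phi> = (\<lambda>t::real. (of_real t + of_real (1 - t) * v) * deriv h (of_real t * z) - (1 - v) * h (of_real t * z) / z
     - ((of_real t + of_real (1 - t) * m) * cnj (z * deriv g (of_real t * z)) / z - (1 - m) * cnj (g (of_real t * z)) / z))"
  define \<Phi>' where "\<Phi>' = (\<lambda>t::real. (of_real t + of_real (1 - t) * v) * (z * deriv (deriv h) (of_real t * z))
     - (of_real t + of_real (1 - t) * m) * cnj (z * (z * deriv (deriv g) (of_real t * z))) / z)"
  \<comment> \<open>\<open>c * \<psi>'\<close> majorises \<open>\<Phi>'\<close>, and \<open>\<psi>\<close> is an antiderivative of \<open>\<psi>'\<close> in closed form;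
      this uses \<open>K' = (4 + 2 x) / (1 - x)\<^sup>4\<close> for \<open>K = (1 + x) / (1 - x)\<^sup>3\<close>\<close>
  define \<psi> where "\<psi> = (\<lambda>t. (t + \<beta> * (1 - t)) * ((1 + t * r) / (1 - t * r)^3) - (1 - \<beta>) * t / (1 - t * r)\<^sup>2)"
  define \<psi>' where "\<psi>' = (\<lambda>t. (t + \<beta> * (1 - t)) * (r * ((4 + 2 * (t * r)) / (1 - t * r)^4)))"
  define c where "c = cmod v / \<beta>"
  have c0: "0 < c"
    unfolding c_def by (rule divide_pos_pos) (use v\<beta> \<beta> in linarith)+
  have "norm (\<Phi> 1 - \<Phi> 0) \<le> c * \<psi> 1 - c * \<psi> 0"
  proof (rule differentiable_bound_general)
    have path: "((\<lambda>t. k (of_real t * z)) has_vector_derivative z * deriv k (of_real t * z)) (at t within S)"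
      if "k holomorphic_on ball 0 1" "0 \<le> t" "t \<le> 1" for k t S
    proof -
      have "(k has_field_derivative deriv k (of_real t * z)) (at (of_real t * z))"
        by (intro holomorphic_derivI[OF that(1) _ tz(1)[OF that(2,3)]]) auto
      moreover have "((\<lambda>t. of_real t * z) has_vector_derivative z) (at t within S)"
        by (auto intro!: derivative_eq_intros)
      ultimately show ?thesis
        using field_vector_diff_chain_within[of "\<lambda>t. of_real t * z" z t S k "deriv k (of_real t * z)"]
        by (auto simp: o_def intro: has_field_derivative_at_within)
    qed
    have der\<Phi>: "(\<Phi> has_vector_derivative \<Phi>' t) (at t within S)" if t: "0 \<le> t" "t \<le> 1" for t S
    proof -
      have w: "((\<lambda>t. of_real t + of_real (1 - t) * x) has_vector_derivative 1 - x) (at t within S)" for x :: complex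
        by (auto intro!: derivative_eq_intros)
      have a: "((\<lambda>t. (of_real t + of_real (1 - t) * v) * deriv h (of_real t * z)) has_vector_derivative
          (of_real t + of_real (1 - t) * v) * (z * deriv (deriv h) (of_real t * z)) + (1 - v) * deriv h (of_real t * z)) (at t within S)"
        by (intro has_vector_derivative_mult w path holomorphic_deriv hol t) auto
      have b: "((\<lambda>t. (1 - v) * h (of_real t * z) / z) has_vector_derivative (1 - v) * (z * deriv h (of_real t * z)) / z) (at t within S)"
        by (intro has_vector_derivative_divide has_vector_derivative_mult_right path hol t)
      have c: "((\<lambda>t. (of_real t + of_real (1 - t) * m) * cnj (z * deriv g (of_real t * z)) / z) has_vector_derivative
          ((of_real t + of_real (1 - t) * m) * cnj (z * (z * deriv (deriv g) (of_real t * z))) + (1 - m) * cnj (z * deriv g (of_real t * z))) / z) (at t within S)"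
        by (intro has_vector_derivative_divide has_vector_derivative_mult w has_vector_derivative_cnj
            has_vector_derivative_mult_right path holomorphic_deriv hol t) auto
      have d: "((\<lambda>t. (1 - m) * cnj (g (of_real t * z)) / z) has_vector_derivative
          (1 - m) * cnj (z * deriv g (of_real t * z)) / z) (at t within S)"
        by (intro has_vector_derivative_divide has_vector_derivative_mult_right has_vector_derivative_cnj path hol t)
      have "\<Phi>' t = (of_real t + of_real (1 - t) * v) * (z * deriv (deriv h) (of_real t * z)) + (1 - v) * deriv h (of_real t * z)
          - (1 - v) * (z * deriv h (of_real t * z)) / z
          - (((of_real t + of_real (1 - t) * m) * cnj (z * (z * deriv (deriv g) (of_real t * z))) + (1 - m) * cnj (z * deriv g (of_real t * z))) / z
             - (1 - m) * cnj (z * deriv g (of_real t * z)) / z)"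
        using z(1) by (simp add: \<Phi>'_def add_divide_distrib)
      then show ?thesis
        unfolding \<Phi>_def using has_vector_derivative_diff[OF has_vector_derivative_diff[OF a b] has_vector_derivative_diff[OF c d]]
        by simp
    qed
    have der\<psi>: "((\<lambda>t. c * \<psi> t) has_real_derivative c * \<psi>' t) (at t within S)" if t: "0 \<le> t" "t \<le> 1" for t S
    proof -
      define s where "s = 1 - t * r"
      have s: "s \<noteq> 0" "t * r = 1 - s"
        using tz(2)[OF t] by (auto simp: s_def)
      have d1: "((\<lambda>t. (1 + t * r) / (1 - t * r)^3) has_real_derivative
          (r * s^3 - (1 + t * r) * (3 * s\<^sup>2 * (- r))) / (s^3)\<^sup>2) (at t within S)"
        unfolding s_def using s(1)[unfolded s_def]
        by (auto intro!: derivative_eq_intros simp: power2_eq_square)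
      have d2: "((\<lambda>t. (1 - \<beta>) * t / (1 - t * r)\<^sup>2) has_real_derivative
          ((1 - \<beta>) * s\<^sup>2 - (1 - \<beta>) * t * (2 * s * (- r))) / (s\<^sup>2)\<^sup>2) (at t within S)"
        unfolding s_def using s(1)[unfolded s_def]
        by (auto intro!: derivative_eq_intros simp: power2_eq_square)
      have d3: "((\<lambda>t. t + \<beta> * (1 - t)) has_real_derivative 1 - \<beta>) (at t within S)"
        by (auto intro!: derivative_eq_intros)
      have d: "(\<psi> has_real_derivative
          ((1 - \<beta>) * ((1 + t * r) / s^3) + (r * s^3 - (1 + t * r) * (3 * s\<^sup>2 * (- r))) / (s^3)\<^sup>2 * (t + \<beta> * (1 - t)))
          - ((1 - \<beta>) * s\<^sup>2 - (1 - \<beta>) * t * (2 * s * (- r))) / (s\<^sup>2)\<^sup>2) (at t within S)"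
        using DERIV_diff[OF DERIV_mult[OF d3 d1] d2] unfolding \<psi>_def s_def .
      have q1: "((1 - \<beta>) * s\<^sup>2 - (1 - \<beta>) * t * (2 * s * (- r))) / (s\<^sup>2)\<^sup>2 = (1 - \<beta>) * ((1 + t * r) / s^3)"
      proof -
        have "(1 - \<beta>) * s\<^sup>2 - (1 - \<beta>) * t * (2 * s * (- r)) = (1 - \<beta>) * (s\<^sup>2 + 2 * s * (t * r))"
          by (simp add: algebra_simps)
        also have "\<dots> = (1 - \<beta>) * (s * (1 + t * r))"
          unfolding s(2) by (simp add: power2_eq_square algebra_simps)
        finally have num: "(1 - \<beta>) * s\<^sup>2 - (1 - \<beta>) * t * (2 * s * (- r)) = (1 - \<beta>) * (s * (1 + t * r))" .
        have den: "(s\<^sup>2)\<^sup>2 = s * s^3"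
          by (simp add: power2_eq_square power3_eq_cube)
        show ?thesis
          unfolding num den using s(1) by simp
      qed
      have q2: "(r * s^3 - (1 + t * r) * (3 * s\<^sup>2 * (- r))) / (s^3)\<^sup>2 = r * ((4 + 2 * (t * r)) / s^4)"
      proof -
        have num: "r * s^3 - (1 + t * r) * (3 * s\<^sup>2 * (- r)) = (r * (4 + 2 * (t * r))) * s\<^sup>2"
          unfolding s(2) by (simp add: power2_eq_square power3_eq_cube algebra_simps)
        have den: "(s^3)\<^sup>2 = s^4 * s\<^sup>2"
          by (simp flip: power_mult power_add)
        show ?thesis
          unfolding num den by (subst mult_divide_mult_cancel_right) (use s(1) in simp_all)
      qed
      have "(\<psi> has_real_derivative \<psi>' t) (at t within S)"
        by (rule DERIV_cong[OF d[unfolded q1 q2]]) (simp add: \<psi>'_def s_def)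
      then show ?thesis
        by (rule DERIV_cmult)
    qed
    show "continuous_on {0..1} \<Phi>"
      by (rule continuous_on_vector_derivative[OF der\<Phi>]) auto
    show "continuous_on {0..1} (\<lambda>t. c * \<psi> t)"
      by (rule DERIV_continuous_on[OF der\<psi>]) auto
    show "(\<Phi> has_vector_derivative \<Phi>' t) (at t)" if "0 < t" "t < 1" for t
      using der\<Phi>[of t UNIV] that by simp
    show "((\<lambda>t. c * \<psi> t) has_vector_derivative c * \<psi>' t) (at t)" if "0 < t" "t < 1" for t
      using der\<psi>[of t UNIV] that by (simp add: has_real_derivative_iff_has_vector_derivative)
    show "norm (\<Phi>' t) \<le> c * \<psi>' t" if t: "0 < t" "t < 1" for t
    proof -
      define H where "H = cmod (deriv (deriv h) (of_real t * z))"
      define G where "G = cmod (deriv (deriv g) (of_real t * z))"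
      have wt: "cmod (of_real t + of_real (1 - t) * x) \<le> t + (1 - t) * cmod v" if "cmod x \<le> cmod v" for x
      proof -
        have "cmod (of_real t + of_real (1 - t) * x) \<le> t + (1 - t) * cmod x"
          using norm_triangle_ineq[of "of_real t" "of_real (1 - t) * x"] t
          by (simp add: norm_mult del: of_real_diff)
        also have "\<dots> \<le> t + (1 - t) * cmod v"
          using that t by (intro add_left_mono mult_left_mono) auto
        finally show ?thesis .
      qed
      have n: "cmod (of_real t * z) = t * r"
        using t by (simp add: norm_mult r_def)
      have HG: "H + G \<le> (4 + 2 * (t * r)) / (1 - t * r)^4"
        using second[of "of_real t * z"] tz(1)[of t] t unfolding n H_def G_def by simp
      have "cmod (\<Phi>' t) \<le> cmod ((of_real t + of_real (1 - t) * v) * (z * deriv (deriv h) (of_real t * z)))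
          + cmod ((of_real t + of_real (1 - t) * m) * cnj (z * (z * deriv (deriv g) (of_real t * z))) / z)"
        unfolding \<Phi>'_def by (rule norm_triangle_ineq4)
      also have "\<dots> = cmod (of_real t + of_real (1 - t) * v) * (r * H) + cmod (of_real t + of_real (1 - t) * m) * (r * G)"
        using z by (simp add: norm_mult norm_divide r_def H_def G_def del: of_real_diff)
      also have "\<dots> \<le> (t + (1 - t) * cmod v) * (r * H) + (t + (1 - t) * cmod v) * (r * G)"
        using r by (intro add_mono mult_right_mono wt mv) (auto simp: H_def G_def)
      also have "\<dots> = (t + (1 - t) * cmod v) * (r * (H + G))"
        by (simp add: algebra_simps)
      also have "\<dots> \<le> (t + (1 - t) * cmod v) * (r * ((4 + 2 * (t * r)) / (1 - t * r)^4))"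
        using t r HG by (intro mult_left_mono) auto
      also have "\<dots> \<le> (c * (t + \<beta> * (1 - t))) * (r * ((4 + 2 * (t * r)) / (1 - t * r)^4))"
      proof (rule mult_right_mono)
        have "t * \<beta> \<le> t * cmod v"
          using t v\<beta> by (intro mult_left_mono) auto
        then show "t + (1 - t) * cmod v \<le> c * (t + \<beta> * (1 - t))"
          using \<beta> by (simp add: c_def field_simps)
        show "0 \<le> r * ((4 + 2 * (t * r)) / (1 - t * r)^4)"
          using t r by simp
      qed
      finally show ?thesis
        by (simp add: \<psi>'_def mult.assoc)
    qed
  qed auto
  moreover have "\<psi> 1 = (1 + r) / (1 - r)^3 - (1 - \<beta>) / (1 - r)\<^sup>2" "\<psi> 0 = \<beta>"
    by (simp_all add: \<psi>_def)
  ultimately have \<Phi>bd: "cmod (\<Phi> 1 - \<Phi> 0) \<le> c * ((1 + r) / (1 - r)^3 - (1 - \<beta>) / (1 - r)\<^sup>2 - \<beta>)"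
    by (simp add: algebra_simps)
  have "A - (1 - v) * B = 0"
    using nz by (simp add: v_def B_def)
  moreover have "(A - (1 - v) * B) / z = v + (\<Phi> 1 - \<Phi> 0) - of_real (2 * (1 - \<beta>)) * cnj (g z) / z"
    using z(1) by (simp add: A_def B_def \<Phi>_def m_def norm field_simps)
  ultimately have "v = of_real (2 * (1 - \<beta>)) * cnj (g z) / z - (\<Phi> 1 - \<Phi> 0)"
    by (simp add: algebra_simps)
  then have "cmod v \<le> cmod (of_real (2 * (1 - \<beta>)) * cnj (g z) / z) + cmod (\<Phi> 1 - \<Phi> 0)"
    by (metis norm_triangle_ineq4)
  moreover have "cmod (of_real (2 * (1 - \<beta>)) * cnj (g z) / z) = 2 * (1 - \<beta>) * cmod (g z) / r"
    using \<beta> by (simp add: norm_mult norm_divide r_def del: of_real_mult of_real_diff)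
  moreover have "2 * (1 - \<beta>) * cmod (g z) / r \<le> c * ((1 - \<beta>) * r / (1 - r)\<^sup>2)"
  proof -
    have "2 * (1 - \<beta>) * cmod (g z) / r \<le> 2 * (1 - \<beta>) * (r\<^sup>2 / (2 * (1 - r)\<^sup>2)) / r"
      using gz \<beta> r by (intro divide_right_mono mult_left_mono) (auto simp: r_def)
    also have "\<dots> = 1 * ((1 - \<beta>) * r / (1 - r)\<^sup>2)"
    proof -
      have cancel: "2 * x * (r\<^sup>2 / (2 * y)) / r = x * r / y" for x y
        using r by (simp add: power2_eq_square)
      show ?thesis
        unfolding cancel by simp
    qed
    also have "\<dots> \<le> c * ((1 - \<beta>) * r / (1 - r)\<^sup>2)"
      using v\<beta> \<beta> r by (intro mult_right_mono) (auto simp: c_def)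
    finally show ?thesis .
  qed
  moreover have "cmod v = c * \<beta>"
    using \<beta> by (simp add: c_def)
  ultimately have "c * \<beta> \<le> c * ((1 - \<beta>) * r / (1 - r)\<^sup>2 + ((1 + r) / (1 - r)^3 - (1 - \<beta>) / (1 - r)\<^sup>2 - \<beta>))"
    using \<Phi>bd by (simp add: distrib_left)
  then have "\<beta> \<le> (1 - \<beta>) * r / (1 - r)\<^sup>2 + ((1 + r) / (1 - r)^3 - (1 - \<beta>) / (1 - r)\<^sup>2 - \<beta>)"
    using c0 by simp
  moreover have "(1 - \<beta>) / (1 - r)\<^sup>2 - (1 - \<beta>) * r / (1 - r)\<^sup>2 = (1 - \<beta>) / (1 - r)"
    using r by (simp add: power2_eq_square divide_simps) (simp add: algebra_simps)
  moreover have "\<alpha> * r / (1 - r) = (1 - \<beta>) / (1 - r) - (1 - \<beta>)"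
    using r by (simp add: \<beta>_def field_simps)
  ultimately show False
    using K unfolding r_def[symmetric] by (simp add: \<beta>_def)
qed

text \<open>The imaginary part of a continuous logarithm \<open>L\<close> of \<open>\<gamma>\<close> is a continuous argument. Near a
point \<open>t\<close> the difference \<open>L s - L t\<close> has small imaginary part, so it is the principal logarithm
of \<open>\<gamma> s / \<gamma> t\<close> and can be differentiated.\<close>

lemma continuous_argument_derivative:
  assumes der: "\<And>t. (\<gamma> has_vector_derivative \<gamma>' t) (at t)" and nz: "\<And>t. \<gamma> t \<noteq> 0"
  obtains \<phi> where "arg_branch \<gamma> \<phi>" "\<And>t. (\<phi> has_real_derivative Im (\<gamma>' t / \<gamma> t)) (at t)"
proof -
  have "continuous_on UNIV \<gamma>"
    using der by (meson continuous_at_imp_continuous_on has_vector_derivative_continuous)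
  moreover have "contractible (UNIV :: real set)"
    by (intro convex_imp_contractible) auto
  ultimately obtain L where L: "continuous_on UNIV L" "\<And>t. \<gamma> t = exp (L t)"
    using nz continuous_logarithm_on_contractible[of UNIV \<gamma>] by (metis UNIV_I)
  have "arg_branch \<gamma> (\<lambda>t. Im (L t))"
    unfolding arg_branch_def
  proof (intro conjI allI)
    show "continuous_on UNIV (\<lambda>t. Im (L t))"
      using L by (intro continuous_intros)
    show "\<gamma> t = of_real (cmod (\<gamma> t)) * cis (Im (L t))" for t
      by (metis L(2) exp_eq_polar norm_exp_eq_Re)
  qed (rule nz)
  moreover have "((\<lambda>t. Im (L t)) has_real_derivative Im (\<gamma>' t / \<gamma> t)) (at t)" for t
  proof -
    have "isCont L t"
      using L(1) by (simp add: continuous_on_eq_continuous_at)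
    then have "\<forall>\<^sub>F s in nhds t. dist (L s) (L t) < pi"
      by (intro tendstoD) (auto simp: isCont_def tendsto_at_iff_tendsto_nhds)
    then obtain U where U: "open U" "t \<in> U" "\<And>s. s \<in> U \<Longrightarrow> dist (L s) (L t) < pi"
      unfolding eventually_nhds by metis
    have Leq: "L t + Ln (\<gamma> s / \<gamma> t) = L s" if "s \<in> U" for s
    proof -
      have "\<bar>Im (L s - L t)\<bar> < pi"
        using U(3)[OF that] abs_Im_le_cmod[of "L s - L t"] unfolding dist_norm by linarith
      then have "Ln (exp (L s - L t)) = L s - L t"
        by (intro Ln_exp) auto
      then show ?thesis
        by (simp add: L(2) exp_diff)
    qed
    have d1: "((\<lambda>s. \<gamma> s / \<gamma> t) has_vector_derivative \<gamma>' t / \<gamma> t) (at t)"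
      by (intro has_vector_derivative_divide der)
    have d2: "(Ln has_field_derivative inverse (\<gamma> t / \<gamma> t)) (at (\<gamma> t / \<gamma> t))"
      by (rule has_field_derivative_Ln) (use nz in \<open>simp add: complex_nonpos_Reals_iff\<close>)
    have "((\<lambda>s. Ln (\<gamma> s / \<gamma> t)) has_vector_derivative \<gamma>' t / \<gamma> t * inverse (\<gamma> t / \<gamma> t)) (at t)"
      using field_vector_diff_chain_at[OF d1 d2] by (simp add: o_def)
    then have "((\<lambda>s. L t + Ln (\<gamma> s / \<gamma> t)) has_vector_derivative 0 + \<gamma>' t / \<gamma> t) (at t)"
      using nz by (intro has_vector_derivative_add) auto
    then have "(L has_vector_derivative 0 + \<gamma>' t / \<gamma> t) (at t)"
      by (rule has_vector_derivative_transform_within_open[OF _ U(1,2) Leq])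
    then have "((\<lambda>s. Im (L s)) has_vector_derivative Im (\<gamma>' t / \<gamma> t)) (at t)"
      using bounded_linear.has_vector_derivative[OF bounded_linear_Im] by fastforce
    then show ?thesis
      by (simp add: has_real_derivative_iff_has_vector_derivative)
  qed
  ultimately show ?thesis
    by (rule that)
qed

section \<open>Starlike images of disks\<close>

text \<open>At the last point where \<open>q \<ge> c\<close>, if it came before \<open>b\<close>, the value would be \<open>c\<close> and \<open>q\<close>
would be increasing there, so that later values would exceed \<open>c\<close>.\<close>

lemma stays_above_level:
  fixes q :: "real \<Rightarrow> real"
  assumes cont: "continuous_on {a..b} q" and "a \<le> b" and qa: "c \<le> q a"
    and der: "\<And>s. a \<le> s \<Longrightarrow> s < b \<Longrightarrow> q s = c \<Longrightarrow> \<exists>d>0. (q has_real_derivative d) (at s)"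
  shows "c \<le> q b"
proof (rule ccontr)
  assume neg: "\<not> c \<le> q b"
  define I where "I = {s \<in> {a..b}. c \<le> q s}"
  have "closed I"
    unfolding I_def by (intro continuous_closed_preimage_constant continuous_on_closed_Collect_le closed_atLeastAtMost cont continuous_on_const)
  moreover have "bounded I"
    by (rule bounded_subset[of "{a..b}"]) (auto simp: I_def)
  ultimately have "compact I"
    by (simp add: compact_eq_bounded_closed)
  moreover have "a \<in> I"
    using qa \<open>a \<le> b\<close> by (simp add: I_def)
  ultimately obtain s where s: "s \<in> I" "\<And>u. u \<in> I \<Longrightarrow> u \<le> s"
    using compact_attains_sup[of I] by blast
  have sb: "a \<le> s" "s < b" "c \<le> q s"
    using s(1) neg by (auto simp: I_def less_eq_real_def)
  have above: "q u < c" if "s < u" "u \<le> b" for u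
    using s(2)[of u] that sb by (force simp: I_def)
  have "q s = c"
  proof (rule ccontr)
    assume "q s \<noteq> c"
    then have "q b \<le> c" "c \<le> q s"
      using sb neg by auto
    then obtain u where "s \<le> u" "u \<le> b" "q u = c"
      using IVT2'[of q b c s] continuous_on_subset[OF cont, of "{s..b}"] sb by auto
    then show False
      using above[of u] \<open>q s \<noteq> c\<close> by (cases "u = s") auto
  qed
  then obtain d where d: "0 < d" "(q has_real_derivative d) (at s)"
    using der sb by blast
  obtain e where e: "0 < e" "\<And>h. 0 < h \<Longrightarrow> h < e \<Longrightarrow> q s < q (s + h)"
    using DERIV_pos_inc_right[OF d(2,1)] by blast
  define h where "h = min (e / 2) (b - s)"
  have "0 < h" "h < e" "s + h \<le> b"
    using e sb by (auto simp: h_def)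
  then show False
    using e(2)[of h] above[of "s + h"] \<open>q s = c\<close> by auto
qed

text \<open>Let \<open>\<zeta>(s)\<close> be the preimage of \<open>s w\<close>; it exists for \<open>0 \<le> s \<le> 1\<close> by convexity. With
\<open>A = z h' - cnj (z g')\<close> at \<open>z = \<zeta>(s)\<close> and velocity \<open>u\<close> of \<open>\<zeta>\<close>,
\<open>Re (A cnj w) = (|h'|\<^sup>2 - |g'|\<^sup>2) Re (cnj z u)\<close>; so positivity of \<open>Re (A / f)\<close> on the circle
means that \<open>|\<zeta>(s)|\<close> increases whenever it equals \<open>r\<close>. Having once reached \<open>r\<close> it could not be
below \<open>r\<close> at \<open>s = 1\<close>.\<close>

lemma image_disk_starlike:
  assumes hol: "h holomorphic_on S" "g holomorphic_on S" and S: "open S"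
    and f: "\<And>w. w \<in> S \<Longrightarrow> f w = h w + cnj (g w)"
    and inj: "inj_on f S" and lt: "\<And>z. z \<in> S \<Longrightarrow> cmod (deriv g z) < cmod (deriv h z)"
    and conv: "convex (f ` S)" and sub: "ball 0 r \<subseteq> S" and r: "0 < r" and f0: "f 0 = 0"
    and star: "\<And>z. z \<in> S \<Longrightarrow> cmod z = r \<Longrightarrow> 0 < Re ((z * deriv h z - cnj (z * deriv g z)) / f z)"
    and w: "w \<in> f ` ball 0 r"
  shows "closed_segment 0 w \<subseteq> f ` ball 0 r"
proof
  fix x assume "x \<in> closed_segment 0 w"
  then obtain a where a: "0 \<le> a" "a \<le> 1" "x = of_real a * w"
    by (auto simp: in_segment scaleR_conv_of_real)
  obtain z0 where z0: "cmod z0 < r" "f z0 = w" "z0 \<in> S"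
    using w sub by auto
  define \<zeta> where "\<zeta> = (\<lambda>s. the_inv_into S f (0 + of_real s * w))"
  have mem: "0 + of_real s * w \<in> f ` S" if "0 \<le> s" "s \<le> 1" for s :: real
  proof -
    have "(1 - s) *\<^sub>R 0 + s *\<^sub>R w \<in> f ` S"
      using z0 sub r f0 that by (intro convexD[OF conv]) (auto intro!: image_eqI[of 0 f 0])
    then show ?thesis
      by (simp add: scaleR_conv_of_real)
  qed
  have \<zeta>S: "\<zeta> s \<in> S" "f (\<zeta> s) = of_real s * w" if "0 \<le> s" "s \<le> 1" for s
    using the_inv_into_into[OF inj mem[OF that] order_refl] f_the_inv_into_f[OF inj mem[OF that]]
    by (auto simp: \<zeta>_def)
  have der: "\<exists>u. (\<zeta> has_vector_derivative u) (at s) \<and> deriv h (\<zeta> s) * u + cnj (deriv g (\<zeta> s) * u) = w"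
    if "0 \<le> s" "s \<le> 1" for s
    unfolding \<zeta>_def
    by (rule segment_preimage_derivative[OF hol S f inj lt mem[OF that]]) blast+
  define q where "q = (\<lambda>s. (cmod (\<zeta> s))\<^sup>2)"
  have qder: "(q has_real_derivative 2 * Re (cnj (\<zeta> s) * u)) (at s)" if "(\<zeta> has_vector_derivative u) (at s)" for s u
  proof -
    have "((\<lambda>s. \<zeta> s \<bullet> \<zeta> s) has_derivative (\<lambda>t. \<zeta> s \<bullet> (t *\<^sub>R u) + (t *\<^sub>R u) \<bullet> \<zeta> s)) (at s)"
      using that unfolding has_vector_derivative_def by (intro has_derivative_inner)
    moreover have "(\<lambda>t. \<zeta> s \<bullet> (t *\<^sub>R u) + (t *\<^sub>R u) \<bullet> \<zeta> s) = (*) (2 * Re (cnj (\<zeta> s) * u))"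
      by (auto simp: inner_complex_def algebra_simps)
    ultimately show ?thesis
      by (simp add: q_def has_field_derivative_def power2_norm_eq_inner)
  qed
  have "cmod (\<zeta> a) < r"
  proof (rule ccontr)
    assume "\<not> cmod (\<zeta> a) < r"
    then have "r\<^sup>2 \<le> q a"
      using r by (simp add: q_def power_mono)
    moreover have "continuous_on {a..1} q"
    proof (rule continuous_at_imp_continuous_on, intro ballI)
      fix s assume "s \<in> {a..1}"
      then obtain u where "(\<zeta> has_vector_derivative u) (at s)"
        using der[of s] a by auto
      then show "isCont q s"
        using qder DERIV_isCont by blast
    qed
    moreover have "\<exists>d>0. (q has_real_derivative d) (at s)" if s: "a \<le> s" "s < 1" "q s = r\<^sup>2" for s
    proof -
      obtain u where u: "(\<zeta> has_vector_derivative u) (at s)"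
        and eq: "deriv h (\<zeta> s) * u + cnj (deriv g (\<zeta> s) * u) = w"
        using der[of s] a s by auto
      define z where "z = \<zeta> s"
      define A where "A = z * deriv h z - cnj (z * deriv g z)"
      have zS: "z \<in> S" "f z = of_real s * w"
        using \<zeta>S[of s] a s by (auto simp: z_def)
      have "cmod z = r"
        using s(3) r by (simp add: q_def z_def)
      then have pos: "0 < Re (A / f z)"
        unfolding A_def by (rule star[OF zS(1)])
      then have "f z \<noteq> 0"
        by auto
      have "Re (A / f z) = Re (A * cnj (f z)) / (cmod (f z))\<^sup>2"
        by (simp add: Re_divide cmod_power2)
      with pos have "0 < Re (A * cnj (f z))"
        by (simp add: zero_less_divide_iff)
      moreover have "Re (A * cnj (f z)) = s * Re (A * cnj w)"
        by (simp add: zS(2) algebra_simps)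
      ultimately have "0 < Re (A * cnj w)"
        using a s by (simp add: zero_less_mult_iff)
      moreover have "Re (A * cnj w) = ((cmod (deriv h z))\<^sup>2 - (cmod (deriv g z))\<^sup>2) * Re (cnj z * u)"
        unfolding A_def eq[folded z_def, symmetric] cmod_power2
        by (simp add: power2_eq_square algebra_simps)
      moreover have "(cmod (deriv g z))\<^sup>2 < (cmod (deriv h z))\<^sup>2"
        using lt[OF zS(1)] by (intro power_strict_mono) auto
      ultimately have "0 < Re (cnj z * u)"
        by (simp add: zero_less_mult_iff)
      then show ?thesis
        using qder[OF u] by (intro exI[of _ "2 * Re (cnj z * u)"]) (simp add: z_def)
    qed
    ultimately have "r\<^sup>2 \<le> q 1"
      using a by (intro stays_above_level[of a 1 q]) auto
    moreover have "\<zeta> 1 = z0"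
      using the_inv_into_f_f[OF inj z0(3)] z0(2) by (simp add: \<zeta>_def)
    ultimately have "r\<^sup>2 \<le> (cmod z0)\<^sup>2"
      by (simp add: q_def)
    then have "r \<le> cmod z0"
      by (rule power2_le_imp_le) simp
    then show False
      using z0 by simp
  qed
  then show "x \<in> f ` ball 0 r"
    using \<zeta>S(2)[OF a(1,2)] a(3) by (intro image_eqI[of _ _ "\<zeta> a"]) auto
qed

section \<open>The radius of full starlikeness\<close>

lemma critical_polynomial_decreasing:
  fixes \<alpha> x y :: real
  assumes \<alpha>: "0 \<le> \<alpha>" "\<alpha> < 1" and xy: "0 \<le> x" "x < y" "y \<le> 1"
  shows "(2 - \<alpha>) * (1 - y)^3 + \<alpha> * y * (1 - y)^2 - 1 - y < (2 - \<alpha>) * (1 - x)^3 + \<alpha> * x * (1 - x)^2 - 1 - x"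
proof (rule DERIV_neg_imp_decreasing[OF xy(2)])
  fix r assume r: "x \<le> r" "r \<le> y"
  have "((\<lambda>r. (2 - \<alpha>) * (1 - r)^3 + \<alpha> * r * (1 - r)^2 - 1 - r) has_real_derivative
      (4 * \<alpha> - 6) * (1 - r)\<^sup>2 - 2 * \<alpha> * r * (1 - r) - 1) (at r)"
    by (auto intro!: derivative_eq_intros simp: power2_eq_square algebra_simps)
  moreover have "(4 * \<alpha> - 6) * (1 - r)\<^sup>2 \<le> 0"
    using \<alpha> by (intro mult_nonpos_nonneg) auto
  moreover have "0 \<le> 2 * \<alpha> * r * (1 - r)"
    using \<alpha> r xy by auto
  ultimately show "\<exists>d. ((\<lambda>r. (2 - \<alpha>) * (1 - r)^3 + \<alpha> * r * (1 - r)^2 - 1 - r) has_real_derivative d) (at r) \<and> d < 0"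
    by (intro exI conjI) (assumption, linarith)
qed

text \<open>To the left of the root the polynomial is positive, and the last conclusion is this
positivity divided by \<open>(1 - r)\<^sup>3\<close>.\<close>

lemma critical_polynomial_unique_root:
  fixes \<alpha> :: real
  assumes \<alpha>: "0 \<le> \<alpha>" "\<alpha> < 1"
  obtains s where "0 < s" "s < 1"
    "{r. 0 < r \<and> r < 1 \<and> (2 - \<alpha>) * (1 - r)^3 + \<alpha> * r * (1 - r)^2 - 1 - r = 0} = {s}"
    "\<And>r. 0 \<le> r \<Longrightarrow> r < s \<Longrightarrow> (1 + r) / (1 - r)^3 < (2 - \<alpha>) + \<alpha> * r / (1 - r)"
proof -
  define p where "p = (\<lambda>r. (2 - \<alpha>) * (1 - r)^3 + \<alpha> * r * (1 - r)^2 - 1 - r)"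
  have dec: "p y < p x" if "0 \<le> x" "x < y" "y \<le> 1" for x y
    unfolding p_def by (rule critical_polynomial_decreasing[OF \<alpha> that])
  have p0: "0 < p 0" and p1: "p 1 < 0"
    using \<alpha> by (auto simp: p_def)
  have "continuous_on {0..1} p"
    unfolding p_def by (intro continuous_intros)
  then obtain s where s: "0 \<le> s" "s \<le> 1" "p s = 0"
    using IVT2'[of p 1 0 0] p0 p1 by auto
  have "s \<noteq> 0" "s \<noteq> 1"
    using s p0 p1 by auto
  with s have s01: "0 < s" "s < 1"
    by auto
  show ?thesis
  proof (rule that[OF s01])
    have "r = s" if "0 < r" "r < 1" "p r = 0" for r
      using dec[of r s] dec[of s r] s that by (cases r s rule: linorder_cases) auto
    then show "{r. 0 < r \<and> r < 1 \<and> (2 - \<alpha>) * (1 - r)^3 + \<alpha> * r * (1 - r)^2 - 1 - r = 0} = {s}"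
      using s s01 unfolding p_def by blast
    fix r assume r: "0 \<le> r" "r < s"
    then have d: "0 < 1 - r"
      using s by simp
    have "0 < p r"
      using dec[of r s] r s by simp
    then have "1 + r < (2 - \<alpha>) * (1 - r)^3 + \<alpha> * r * (1 - r)^2"
      by (simp add: p_def)
    also have "\<dots> = ((2 - \<alpha>) + \<alpha> * r / (1 - r)) * (1 - r)^3"
      using d by (simp add: field_simps power2_eq_square power3_eq_cube)
    finally show "(1 + r) / (1 - r)^3 < (2 - \<alpha>) + \<alpha> * r / (1 - r)"
      using d by (simp add: pos_divide_less_eq)
  qed
qed

lemma power_series_first_coefficients:
  fixes a :: "nat \<Rightarrow> complex"
  assumes "\<And>z. z \<in> ball 0 1 \<Longrightarrow> (\<lambda>n. a n * z ^ n) sums h z"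
  shows "h 0 = a 0" "deriv h 0 = a 1"
proof -
  show "h 0 = a 0"
    using assms[of 0] sums_unique2 powser_sums_zero[of a] by fastforce
  have "((\<lambda>z. \<Sum>n. a n * z ^ n) has_field_derivative (\<Sum>n. diffs a n * 0 ^ n)) (at 0)"
    by (rule termdiffs_strong[of a "1/2"]) (use assms[of "1/2"] in \<open>auto simp: sums_iff\<close>)
  moreover have "(\<Sum>n. diffs a n * 0 ^ n) = a 1"
    by (simp add: powser_zero diffs_def)
  ultimately have "((\<lambda>z. \<Sum>n. a n * z ^ n) has_field_derivative a 1) (at 0)"
    by simp
  then have "(h has_field_derivative a 1) (at 0)"
    by (rule has_field_derivative_transform_within_open[where S = "ball 0 1"])
       (use assms in \<open>auto simp: sums_iff\<close>)
  then show "deriv h 0 = a 1"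
    by (rule DERIV_imp_deriv)
qed

lemma wirtinger_bar_harmonic:
  assumes "h holomorphic_on S" "g holomorphic_on S" "open S" "z \<in> S"
    and "\<And>w. w \<in> S \<Longrightarrow> f w = h w + cnj (g w)"
  shows "wirtinger_bar f z = cnj (deriv g z)"
proof -
  have "frechet_derivative f (at z) = (\<lambda>u. deriv h z * u + cnj (deriv g z * u))"
    by (rule frechet_derivative_at[OF harmonic_has_derivative[OF assms], symmetric])
  then show ?thesis
    by (simp add: wirtinger_bar_def dir_deriv_def algebra_simps)
qed

lemma harmonic_on_subset:
  assumes "harmonic_on f S" "open T" "T \<subseteq> S"
  shows "harmonic_on f T"
  using assms unfolding harmonic_on_def
  by (auto intro: differentiable_on_subset continuous_on_subset)

lemma K_H0_decomposition:
  assumes "f \<in> K_H0"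
  obtains h g where "h holomorphic_on unit_disk" "g holomorphic_on unit_disk"
    "h 0 = 0" "deriv h 0 = 1" "g 0 = 0" "deriv g 0 = 0"
    "\<And>z. z \<in> unit_disk \<Longrightarrow> f z = h z + cnj (g z)"
    "\<And>z. z \<in> unit_disk \<Longrightarrow> cmod (deriv g z) < cmod (deriv h z)"
proof -
  from assms obtain h g a b where
    hol: "h holomorphic_on unit_disk" "g holomorphic_on unit_disk"
    and ab: "a 0 = 0" "a 1 = 1" "b 0 = 0"
    and sums: "\<And>z. z \<in> unit_disk \<Longrightarrow> (\<lambda>n. a n * z ^ n) sums h z"
      "\<And>z. z \<in> unit_disk \<Longrightarrow> (\<lambda>n. b n * z ^ n) sums g z"
    and f: "\<And>z. z \<in> unit_disk \<Longrightarrow> f z = h z + cnj (g z)"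
    and lt: "\<And>z. z \<in> unit_disk \<Longrightarrow> cmod (deriv g z) < cmod (deriv h z)"
    and wb: "wirtinger_bar f 0 = 0"
    unfolding K_H0_def S_H_def by blast
  have "cnj (deriv g 0) = 0"
    using wirtinger_bar_harmonic[OF hol open_ball _ f, of 0] wb by simp
  then show ?thesis
    using that[OF hol _ _ _ _ f lt] power_series_first_coefficients[OF sums(1)]
      power_series_first_coefficients[OF sums(2)] ab by simp
qed

theorem corollary3p6:
  fixes f :: "complex \<Rightarrow> complex" and \<alpha> :: real
  assumes "f \<in> K_H0" and "0 \<le> \<alpha>" and "\<alpha> < 1"
  shows "\<exists>r\<^sub>S. {r::real. 0 < r \<and> r < 1 \<and>
                (2 - \<alpha>) * (1 - r) ^ 3 + \<alpha> * r * (1 - r) ^ 2 - 1 - r = 0} = {r\<^sub>S} \<and>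
              fully_starlike_of_order \<alpha> r\<^sub>S f"
proof -
  have inj: "inj_on f unit_disk" and harm: "harmonic_on f unit_disk" and conv: "convex (f ` unit_disk)"
    using assms(1) unfolding K_H0_def S_H_def by auto
  obtain h g where hol: "h holomorphic_on unit_disk" "g holomorphic_on unit_disk"
    and norm: "h 0 = 0" "deriv h 0 = 1" "g 0 = 0" "deriv g 0 = 0"
    and f: "\<And>z. z \<in> unit_disk \<Longrightarrow> f z = h z + cnj (g z)"
    and lt: "\<And>z. z \<in> unit_disk \<Longrightarrow> cmod (deriv g z) < cmod (deriv h z)"
    by (rule K_H0_decomposition[OF assms(1)]) blast
  have inj\<epsilon>: "inj_on (\<lambda>z. h z + \<epsilon> * g z) unit_disk" if "cmod \<epsilon> = 1" for \<epsilon>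
  proof (rule inj_onI, rule ccontr)
    fix z1 z2 assume z: "z1 \<in> unit_disk" "z2 \<in> unit_disk" "z1 \<noteq> z2"
      and "h z1 + \<epsilon> * g z1 = h z2 + \<epsilon> * g z2"
    then have "h z2 - h z1 = - (\<epsilon> * (g z2 - g z1))"
      by (simp add: algebra_simps add_eq_0_iff)
    then have "cmod (h z2 - h z1) = cmod (g z2 - g z1)"
      using that by (simp add: norm_mult)
    then show False
      using convex_harmonic_difference_bound[OF hol open_ball f inj lt conv z] by simp
  qed
  note dist = pair_distortion[OF hol inj\<epsilon> norm(2,4)]
  have f0: "f 0 = 0"
    using f[of 0] norm by simp
  have fnz: "f z \<noteq> 0" if "z \<in> unit_disk" "z \<noteq> 0" for z
    using inj_onD[OF inj, of z 0] that f0 by auto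
  have contf: "continuous_on unit_disk f"
    using harm unfolding harmonic_on_def by (blast intro: differentiable_imp_continuous_on)
  obtain s where s: "0 < s" "s < 1"
    and root: "{r. 0 < r \<and> r < 1 \<and> (2 - \<alpha>) * (1 - r) ^ 3 + \<alpha> * r * (1 - r) ^ 2 - 1 - r = 0} = {s}"
    and below: "\<And>r. 0 \<le> r \<Longrightarrow> r < s \<Longrightarrow> (1 + r) / (1 - r)^3 < (2 - \<alpha>) + \<alpha> * r / (1 - r)"
    by (rule critical_polynomial_unique_root[OF assms(2,3)]) blast
  have arg: "\<alpha> < Re ((z * deriv h z - cnj (z * deriv g z)) / f z)" if z: "z \<noteq> 0" "cmod z < s" for z
  proof -
    have z1: "cmod z < 1" "z \<in> unit_disk"
      using z s by auto
    have "cmod (g z) \<le> (cmod z)\<^sup>2 / (2 * (1 - cmod z)\<^sup>2)"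
      by (rule coanalytic_part_growth[OF hol lt norm(3,4) _ z1(1)]) (use dist(1) in auto)
    then show ?thesis
      using argument_derivative_lower_bound[OF hol norm _ _ assms(2,3) z(1) z1(1) below] dist(2)
        fnz[OF z1(2) z(1)] z f[OF z1(2)] by simp
  qed
  have "fully_starlike_of_order \<alpha> s f"
    unfolding fully_starlike_of_order_def
  proof (intro conjI allI impI)
    show "harmonic_on f (ball 0 s)"
      by (rule harmonic_on_subset[OF harm]) (use s in auto)
    show "f 0 = 0" by (rule f0)
    fix r assume "0 < r \<and> r < s"
    then have r: "0 < r" "r < s" "r < 1"
      using s by auto
    have sub: "ball 0 r \<subseteq> unit_disk" "cball 0 r \<subseteq> unit_disk" "sphere 0 r \<subseteq> unit_disk"
      using r by auto
    show "inj_on f (sphere 0 r)"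
      by (rule inj_on_subset[OF inj sub(3)])
    show "\<exists>D. starlike_domain D \<and> bounded D \<and> frontier D = f ` sphere 0 r"
    proof (intro exI conjI)
      have op: "open (f ` ball 0 r)"
        by (rule invariance_of_domain[OF continuous_on_subset[OF contf sub(1)] open_ball inj_on_subset[OF inj sub(1)]])
      have star: "closed_segment 0 w \<subseteq> f ` ball 0 r" if "w \<in> f ` ball 0 r" for w
      proof (rule image_disk_starlike[OF hol open_ball f inj lt conv sub(1) r(1) f0 _ that])
        fix z assume "z \<in> unit_disk" "cmod z = r"
        then show "0 < Re ((z * deriv h z - cnj (z * deriv g z)) / f z)"
          using arg[of z] r assms(2) by auto
      qed
      show "starlike_domain (f ` ball 0 r)"
        unfolding starlike_domain_def
      proof (intro conjI ballI op star)
        show "connected (f ` ball 0 r)"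
          by (rule connected_continuous_image[OF continuous_on_subset[OF contf sub(1)]]) auto
        show "0 \<in> f ` ball 0 r"
          using f0 r by (intro image_eqI[of _ _ 0]) auto
      qed
      have comp: "compact (f ` cball 0 r)"
        by (rule compact_continuous_image[OF continuous_on_subset[OF contf sub(2)]]) auto
      then show "bounded (f ` ball 0 r)"
        by (rule bounded_subset[OF compact_imp_bounded]) auto
      have "closure (f ` ball 0 r) = f ` cball 0 r"
      proof (rule antisym)
        show "closure (f ` ball 0 r) \<subseteq> f ` cball 0 r"
          by (rule closure_minimal) (use comp compact_imp_closed in auto)
        have "f ` closure (ball 0 r) \<subseteq> closure (f ` ball 0 r)"
          using r by (intro image_closure_subset continuous_on_subset[OF contf]) (auto simp: closure_subset)
        then show "f ` cball 0 r \<subseteq> closure (f ` ball 0 r)"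
          using r by simp
      qed
      then have "frontier (f ` ball 0 r) = f ` cball 0 r - f ` ball 0 r"
        using op by (simp add: frontier_def interior_open)
      also have "\<dots> = f ` (cball 0 r - ball 0 r)"
        by (rule inj_on_image_set_diff[OF inj, symmetric]) (use sub in auto)
      also have "cball 0 r - ball 0 r = sphere (0::complex) r"
        by auto
      finally show "frontier (f ` ball 0 r) = f ` sphere 0 r" .
    qed
    define \<gamma> where "\<gamma> = (\<lambda>\<theta>. f (of_real r * cis \<theta>))"
    define A where "A = (\<lambda>z. z * deriv h z - cnj (z * deriv g z))"
    have circ: "of_real r * cis \<theta> \<in> unit_disk" "of_real r * cis \<theta> \<noteq> 0" "cmod (of_real r * cis \<theta>) < s" for \<theta>
      using r by (auto simp: norm_mult)
    \<comment> \<open>hence the argument of \<open>\<gamma>\<close> has derivative \<open>Im (\<i> A / f) = Re (A / f)\<close>\<close>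
    have der: "(\<gamma> has_vector_derivative \<i> * A (of_real r * cis \<theta>)) (at \<theta>)" for \<theta>
    proof -
      define z where "z = of_real r * cis \<theta>"
      have "(cis has_vector_derivative \<i> * cis \<theta>) (at \<theta>)"
        by (auto intro!: derivative_eq_intros simp: has_vector_derivative_def scaleR_conv_of_real)
      then have "((\<lambda>\<theta>. of_real r * cis \<theta>) has_vector_derivative of_real r * (\<i> * cis \<theta>)) (at \<theta>)"
        by (rule has_vector_derivative_mult_right)
      moreover have "(f has_derivative (\<lambda>u. deriv h z * u + cnj (deriv g z * u))) (at z)"
        unfolding z_def by (rule harmonic_has_derivative[OF hol open_ball circ(1) f])
      ultimately have "((\<lambda>\<theta>. f (of_real r * cis \<theta>)) has_derivative
          (\<lambda>t. deriv h z * (t *\<^sub>R (of_real r * (\<i> * cis \<theta>))) + cnj (deriv g z * (t *\<^sub>R (of_real r * (\<i> * cis \<theta>)))))) (at \<theta>)"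
        unfolding has_vector_derivative_def z_def by (rule has_derivative_compose)
      moreover have "(\<lambda>t. deriv h z * (t *\<^sub>R (of_real r * (\<i> * cis \<theta>))) + cnj (deriv g z * (t *\<^sub>R (of_real r * (\<i> * cis \<theta>)))))
          = (\<lambda>t. t *\<^sub>R (\<i> * A z))"
        by (simp add: A_def z_def scaleR_conv_of_real algebra_simps fun_eq_iff)
      ultimately show ?thesis
        unfolding \<gamma>_def z_def has_vector_derivative_def by simp
    qed
    obtain \<phi> where \<phi>: "arg_branch \<gamma> \<phi>"
      "\<And>\<theta>. (\<phi> has_real_derivative Im (\<i> * A (of_real r * cis \<theta>) / \<gamma> \<theta>)) (at \<theta>)"
      by (rule continuous_argument_derivative[OF der]) (use fnz circ in \<open>auto simp: \<gamma>_def\<close>)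
    have "\<alpha> < Im (\<i> * A (of_real r * cis \<theta>) / \<gamma> \<theta>)" for \<theta>
      using arg[OF circ(2,3)] unfolding A_def \<gamma>_def by (metis Im_i_times times_divide_eq_right)
    then show "\<exists>\<phi>. arg_branch (\<lambda>\<theta>. f (of_real r * cis \<theta>)) \<phi> \<and>
           (\<forall>\<theta>\<in>{0..2 * pi}. \<exists>d. (\<phi> has_real_derivative d) (at \<theta>) \<and> d > \<alpha>)"
      using \<phi> unfolding \<gamma>_def by blast
  qed
  with root show ?thesis
    by blast
qed

end
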